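(* Let $a$ be a positive integer and $b$ an integer with $b>-a$ and $\gcd(a,5b)=1$. Let $n$ be an integer with $$n\geq 550a(60a^2+b)+25(120a^2+b)\sqrt{2(60a^2+b)},$$ and suppose that $n$ is even if $ab$ is odd. Then there are $w,x,y,z\in\mathbb{N}$ such that $$2w(aw+b)+x(ax+b)+y(ay+b)+z(az+b)=n.$$
   Context: $\mathbb{N}=\{0,1,2,\ldots\}$. *)

theory Defs
  imports Complex_Main
begin

end

theory Submission
  imports Defs "HOL-Number_Theory.Number_Theory" "HOL-Library.Product_Plus"
begin

text \<open>
  Put \<open>S = 2w\<^sup>2 + x\<^sup>2 + y\<^sup>2 + z\<^sup>2\<close> and \<open>T = 2w + x + y + z\<close>, so that the equation reads \<open>n = aS + bT\<close>.
  The bound on \<open>n\<close> leaves an interval of at least \<open>4a\<close> consecutive \<open>T\<close> in which \<open>T\<^sup>2 < 5S\<close> and \<open>4S \<le> T\<^sup>2\<close>;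
  among them there is one with \<open>n - bT\<close> divisible by \<open>a\<close>, \<open>S \<equiv> T\<close> modulo 2 and \<open>5\<close> not dividing \<open>T\<close>.

  For such a pair one finds a positive definite integral quaternary lattice of determinant 2 that contains
  vectors \<open>e\<close>, \<open>v\<close> with \<open>\<langle>e,e\<rangle> = 5\<close>, \<open>\<langle>v,e\<rangle> = T\<close>, \<open>\<langle>v,v\<rangle> = S\<close> and in which \<open>e\<close> is characteristic. Lattice
  reduction shows that the lattice is \<open>diag(1,1,1,2)\<close>, where a characteristic vector of norm 5 must be
  \<open>(\<plusminus>1,\<plusminus>1,\<plusminus>1,\<plusminus>1)\<close>; the coordinates of \<open>v\<close> give \<open>w, x, y, z\<close>. The tridiagonal Gram matrix of the lattice needs a
  prime in a prescribed class modulo squares, together with quadratic reciprocity. Existence of that prime is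
  Dirichlet's argument with real characters only.
\<close>

subsection \<open>Summation by parts and Chebyshev's bound\<close>

text \<open>Summation by parts leaves two boundary terms, at most \<open>C * f n\<close> and
  \<open>C * f m\<close>, and a sum against the differences of \<open>f\<close> that telescopes to
  at most \<open>C * (f m - f n)\<close>.\<close>

lemma abel_summation_bound:
  fixes c f :: "nat \<Rightarrow> real"
  assumes C: "\<And>n. \<bar>\<Sum>k<n. c k\<bar> \<le> C"
    and f: "\<And>k. m \<le> k \<Longrightarrow> f (Suc k) \<le> f k" "\<And>k. m \<le> k \<Longrightarrow> 0 \<le> f k"
    and mn: "m \<le> n"
  shows "\<bar>\<Sum>k=m..<n. c k * f k\<bar> \<le> 2 * C * f m"
proof -
  define A where "A n = (\<Sum>k<n. c k)" for n
  have id: "(\<Sum>k=m..<n. c k * f k) = A n * f n - A m * f m + (\<Sum>k=m..<n. A (Suc k) * (f k - f (Suc k)))"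
    using mn by (induction n rule: dec_induct) (auto simp: A_def algebra_simps)
  have tele: "(\<Sum>k=m..<n. C * (f k - f (Suc k))) = C * (f m - f n)"
    using mn by (induction n rule: dec_induct) (auto simp: algebra_simps)
  have "\<bar>\<Sum>k=m..<n. A (Suc k) * (f k - f (Suc k))\<bar> \<le> (\<Sum>k=m..<n. C * (f k - f (Suc k)))"
    using C f by (intro order.trans[OF sum_abs] sum_mono)
      (auto simp: A_def abs_mult simp del: sum.lessThan_Suc intro!: mult_right_mono)
  moreover have "\<bar>A n * f n\<bar> \<le> C * f n"
    using C[of n] f(2)[OF mn] by (auto simp: A_def abs_mult intro!: mult_right_mono)
  moreover have "\<bar>A m * f m\<bar> \<le> C * f m"
    using C[of m] f(2)[of m] by (auto simp: A_def abs_mult intro!: mult_right_mono)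
  ultimately show ?thesis unfolding id tele by (simp add: algebra_simps)
qed

text \<open>Both sides run over the pairs of positive \<open>d\<close>, \<open>k\<close> with
  \<open>d * k \<le> N\<close>. It serves for \<open>ln (fact n)\<close>, for the convolution with
  \<open>mangoldt\<close> and for the Lambert series.\<close>

lemma sum_divisors_rearrange:
  fixes F :: "nat \<Rightarrow> nat \<Rightarrow> 'a :: comm_monoid_add"
  shows "(\<Sum>n=1..N. \<Sum>d | d dvd n. F d (n div d)) = (\<Sum>d=1..N. \<Sum>k=1..N div d. F d k)"
proof -
  have "(\<Sum>n=1..N. \<Sum>d | d dvd n. F d (n div d)) = (\<Sum>(n,d)\<in>Sigma {1..N} (\<lambda>n. {d. d dvd n}). F d (n div d))"
    by (intro sum.Sigma) (auto intro: finite_divisors_nat)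
  also have "\<dots> = (\<Sum>(d,k)\<in>Sigma {1..N} (\<lambda>d. {1..N div d}). F d k)"
    by (rule sum.reindex_bij_witness[of _ "\<lambda>(d,k). (d * k, d)" "\<lambda>(n,d). (d, n div d)"])
       (auto simp: Suc_le_eq less_eq_div_iff_mult_less_eq mult.commute elim!: dvdE,
        metis dvd_imp_le dvd_triv_left le_trans nat_0_less_mult_iff)
  also have "\<dots> = (\<Sum>d=1..N. \<Sum>k=1..N div d. F d k)"
    by (intro sum.Sigma[symmetric]) auto
  finally show ?thesis .
qed

text \<open>Chebyshev's argument: in the logarithm of the central binomial coefficient,
  \<open>mangoldt d\<close> has the weight floor(2n/d) - 2 floor(n/d), which is nonnegative and
  equals 1 for n < d \<le> 2n. This bounds the sum over such \<open>d\<close> by 2n ln 2, and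
  halving \<open>N\<close> gives an induction.\<close>

lemma sum_mangoldt_le: "(\<Sum>d=1..N. mangoldt d :: real) \<le> 4 * real N"
proof -
  have lnfact: "ln (fact n) = (\<Sum>d=1..n. mangoldt d * real (n div d))" for n
  proof -
    have "ln (fact n :: real) = (\<Sum>k=1..n. ln (real k))"
      unfolding fact_prod of_nat_prod by (subst ln_prod) auto
    also have "\<dots> = (\<Sum>k=1..n. \<Sum>d | d dvd k. mangoldt d)"
      by (intro sum.cong) (auto simp: mangoldt_sum)
    also have "\<dots> = (\<Sum>d=1..n. \<Sum>k=1..n div d. mangoldt d)"
      by (rule sum_divisors_rearrange)
    finally show ?thesis by (simp add: mult.commute)
  qed
  have step: "(\<Sum>d=n+1..2*n. mangoldt d) \<le> real (2 * n) * ln 2" for n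
  proof -
    have "(\<Sum>d=n+1..2*n. mangoldt d :: real) \<le> (\<Sum>d=1..2*n. mangoldt d * (real (2*n div d) - 2 * real (n div d)))"
    proof (rule order.trans[OF _ sum_mono2[of _ "{n+1..2*n}"]])
      show "(\<Sum>d=n+1..2*n. mangoldt d :: real) \<le> (\<Sum>d=n+1..2*n. mangoldt d * (real (2*n div d) - 2 * real (n div d)))"
      proof (intro sum_mono)
        fix d assume d: "d \<in> {n+1..2*n}"
        hence "n div d = 0" "2 * n div d = 1" by (auto intro!: div_nat_eqI)
        thus "(mangoldt d :: real) \<le> mangoldt d * (real (2*n div d) - 2 * real (n div d))" by simp
      qed
    next
      fix d assume "d \<in> {1..2*n} - {n+1..2*n}"
      hence "d > 0" by auto
      have "2 * (n div d) * d \<le> 2 * n" by (simp add: mult.assoc)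
      hence "2 * (n div d) \<le> 2 * n div d" using \<open>d > 0\<close> by (simp add: less_eq_div_iff_mult_less_eq)
      hence "2 * real (n div d) \<le> real (2 * n div d)" by (metis of_nat_le_iff of_nat_mult of_nat_numeral)
      thus "0 \<le> (mangoldt d :: real) * (real (2*n div d) - 2 * real (n div d))"
        by (intro mult_nonneg_nonneg mangoldt_nonneg) auto
    qed auto
    also have "\<dots> = ln (fact (2*n)) - 2 * (\<Sum>d=1..2*n. mangoldt d * real (n div d))"
      by (simp add: lnfact algebra_simps sum_subtractf sum_distrib_left)
    also have "(\<Sum>d=1..2*n. mangoldt d * real (n div d)) = ln (fact n)"
      unfolding lnfact by (rule sum.mono_neutral_right) auto
    also have "ln (fact (2*n)) - 2 * ln (fact n) = ln (real (2 * n choose n))"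
      by (simp add: binomial_fact ln_div ln_mult)
    also have "\<dots> \<le> ln (2 ^ (2 * n))"
      using binomial_le_pow2[of "2*n" n] by (simp add: ln_le_cancel_iff flip: of_nat_power)
    finally show ?thesis by (simp add: ln_realpow)
  qed
  have ln2: "ln (2::real) \<le> 1" using ln_le_minus_one[of 2] by simp
  show ?thesis
  proof (induction N rule: less_induct)
    case (less N)
    show ?case
    proof (cases "N \<le> 1")
      case True
      hence "N = 0 \<or> N = 1" by auto
      thus ?thesis by auto
    next
      case False
      define n where "n = N div 2"
      have n: "n < N" "n \<ge> 1" "N = 2 * n \<or> N = 2 * n + 1" using False by (auto simp: n_def)
      have "{1..2*n} = {1..n} \<union> {n+1..2*n}" by auto
      hence "(\<Sum>d=1..2*n. mangoldt d :: real) = (\<Sum>d=1..n. mangoldt d) + (\<Sum>d=n+1..2*n. mangoldt d)"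
        by (simp add: sum.union_disjoint)
      also have "\<dots> \<le> 4 * real n + real (2 * n) * 1"
        using less[OF n(1)] step[of n] ln2 mult_left_mono[OF ln2, of "real (2 * n)"] by linarith
      finally have *: "(\<Sum>d=1..2*n. mangoldt d :: real) \<le> 6 * real n" by simp
      have "(mangoldt (2 * n + 1) :: real) \<le> real (2 * n + 1) - 1"
        using mangoldt_le[of "2*n+1"] ln_le_minus_one[of "real (2 * n + 1)"] by simp
      with n(3) * show ?thesis by auto
    qed
  qed
qed


subsection \<open>Real characters\<close>

text \<open>Real Dirichlet characters modulo \<open>M\<close>, on natural numbers standing for
  residues. They suffice to separate classes modulo squares.\<close>

locale quadratic_character =
  fixes M :: nat and \<chi> :: "nat \<Rightarrow> real"
  assumes modulus_pos: "M > 0"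
    and not_coprime: "\<not> coprime n M \<Longrightarrow> \<chi> n = 0"
    and coprime: "coprime n M \<Longrightarrow> \<chi> n = 1 \<or> \<chi> n = -1"
    and mult: "\<chi> (m * n) = \<chi> m * \<chi> n"
    and periodic: "\<chi> (n mod M) = \<chi> n"
begin

lemma abs_le_1: "\<bar>\<chi> n\<bar> \<le> 1"
  using not_coprime[of n] coprime[of n] by (cases "coprime n M") auto

lemma abs_mult_le: "0 \<le> t \<Longrightarrow> t \<le> u \<Longrightarrow> \<bar>\<chi> n * t\<bar> \<le> u"
  using mult_mono[OF abs_le_1[of n], of t u] by (simp add: abs_mult)

lemma one: "\<chi> 1 = 1"
  using coprime[of 1] mult[of 1 1] by auto

lemma power: "\<chi> (n ^ k) = \<chi> n ^ k"
  by (induction k) (use one in \<open>auto simp: mult\<close>)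

end

text \<open>Every divisor of \<open>p ^ e * m\<close> is uniquely \<open>p ^ j * d\<close> with
  \<open>j \<le> e\<close> and \<open>d dvd m\<close>, the exponent \<open>j\<close> being its
  multiplicity of \<open>p\<close>; multiplicativity then splits the sum.\<close>

lemma sum_divisors_prime_power_times:
  fixes f :: "nat \<Rightarrow> 'a :: comm_semiring_1"
  assumes p: "prime p" and m: "\<not> p dvd m" "m > 0"
    and f: "\<And>x y. f (x * y) = f x * f y"
  shows "(\<Sum>d | d dvd p ^ e * m. f d) = (\<Sum>j\<le>e. f (p ^ j)) * (\<Sum>d | d dvd m. f d)"
proof -
  have cop: "coprime (p ^ j) d" if "d dvd m" for d j
    using p m that by (metis coprime_power_left_iff prime_imp_coprime dvd_trans)
  have inj: "inj_on (\<lambda>(j, d). p ^ j * d) ({..e} \<times> {d. d dvd m})"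
  proof (rule inj_onI, clarsimp)
    fix i j c d assume cd: "c dvd m" "d dvd m" and eq: "p ^ i * c = p ^ j * d"
    have "\<not> p dvd c" "\<not> p dvd d" using cd m by (auto dest: dvd_trans)
    hence "multiplicity p (p ^ i * c) = i" "multiplicity p (p ^ j * d) = j"
      using p by (auto intro!: multiplicity_eqI simp: prime_gt_0_nat mult.commute[of p])
    with eq p show "i = j \<and> c = d" by (auto simp: prime_gt_0_nat)
  qed
  have "{d. d dvd p ^ e * m} = (\<lambda>(j, d). p ^ j * d) ` ({..e} \<times> {d. d dvd m})" (is "?L = ?R")
  proof
    show "?R \<subseteq> ?L" by (auto intro!: mult_dvd_mono le_imp_power_dvd)
    show "?L \<subseteq> ?R"
    proof
      fix d assume "d \<in> ?L"
      then obtain x y where "d = x * y" "x dvd p ^ e" "y dvd m" using division_decomp[of d "p ^ e" m] by auto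
      with p show "d \<in> ?R" by (auto simp: divides_primepow_nat)
    qed
  qed
  hence "(\<Sum>d | d dvd p ^ e * m. f d) = (\<Sum>(j,d)\<in>{..e} \<times> {d. d dvd m}. f (p ^ j * d))"
    using inj by (simp add: sum.reindex case_prod_beta' comp_def)
  also have "\<dots> = (\<Sum>j\<le>e. f (p ^ j)) * (\<Sum>d | d dvd m. f d)"
    by (simp add: f sum_product sum.cartesian_product)
  finally show ?thesis .
qed

context quadratic_character begin

text \<open>Expands \<open>ln n\<close> as the sum of \<open>mangoldt d\<close> over the divisors of
  \<open>n\<close> and splits \<chi>(n) as \<chi>(d) \<chi>(n/d).\<close>

lemma sum_ln_convolution:
  "(\<Sum>n=1..N. \<chi> n * ln n / n) = (\<Sum>d=1..N. (\<chi> d * mangoldt d / d) * (\<Sum>k=1..N div d. \<chi> k / k))"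
proof -
  have "(\<Sum>n=1..N. \<chi> n * ln n / n) = (\<Sum>n=1..N. \<Sum>d | d dvd n. (\<chi> d * mangoldt d / d) * (\<chi> (n div d) / real (n div d)))"
  proof (intro sum.cong refl)
    fix n assume n: "n \<in> {1..N}"
    hence "\<chi> n * ln n / n = (\<Sum>d | d dvd n. \<chi> n * mangoldt d / n)"
      by (simp add: mangoldt_sum flip: sum_distrib_left sum_divide_distrib)
    also have "\<dots> = (\<Sum>d | d dvd n. (\<chi> d * mangoldt d / d) * (\<chi> (n div d) / real (n div d)))"
      by (intro sum.cong refl) (auto elim!: dvdE simp: mult)
    finally show "\<chi> n * ln n / n = (\<Sum>d | d dvd n. (\<chi> d * mangoldt d / d) * (\<chi> (n div d) / real (n div d)))" .
  qed
  also have "\<dots> = (\<Sum>d=1..N. \<Sum>k=1..N div d. (\<chi> d * mangoldt d / d) * (\<chi> k / k))"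
    by (rule sum_divisors_rearrange)
  finally show ?thesis by (simp only: sum_distrib_left)
qed

text \<open>Splitting off a prime power \<open>p ^ e\<close> contributes the factor 1 + \<chi>(p) +
  ... + \<chi>(p)^e. It is 1 or e + 1 if \<chi>(p) is 0 or 1; if \<chi>(p) = -1, it is 1 for even
  \<open>e\<close> and 0 for odd \<open>e\<close>. In a square all exponents are even.\<close>

lemma sum_divisors_nonneg_ge_1:
  assumes "n > 0"
  shows "(\<Sum>d | d dvd n. \<chi> d) \<ge> 0 \<and> ((\<exists>k. n = k\<^sup>2) \<longrightarrow> (\<Sum>d | d dvd n. \<chi> d) \<ge> 1)"
  using assms
proof (induction n rule: less_induct)
  case (less n)
  show ?case
  proof (cases "n = 1")
    case True
    thus ?thesis using one by auto
  next
    case False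
    then obtain p where p: "prime p" "p dvd n" using prime_factor_nat by blast
    define e where "e = multiplicity p n"
    obtain m where m: "n = p ^ e * m" "\<not> p dvd m"
      using multiplicity_decompose'[of n p] less.prems p not_prime_unit[of p] unfolding e_def by blast
    have "e > 0" using p m(2) m(1) by (cases e) auto
    hence "1 < p ^ e" using p prime_gt_1_nat one_less_power by blast
    hence mn: "m < n" "m > 0" using m less.prems by (auto intro!: gr0I)
    have "\<chi> p = 0 \<or> \<chi> p = 1 \<or> \<chi> p = -1" using coprime not_coprime by blast
    hence geo: "(\<Sum>j\<le>k. \<chi> p ^ j) \<ge> 0 \<and> (even k \<longrightarrow> (\<Sum>j\<le>k. \<chi> p ^ j) \<ge> 1)" for k
    proof (elim disjE)
      assume "\<chi> p = -1"
      moreover have "(\<Sum>j\<le>k. (-1 :: real) ^ j) = (if even k then 1 else 0)" by (induction k) auto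
      ultimately show ?thesis by auto
    qed (auto simp: power_0_left)
    have r: "(\<Sum>d | d dvd n. \<chi> d) = (\<Sum>j\<le>e. \<chi> p ^ j) * (\<Sum>d | d dvd m. \<chi> d)"
      unfolding m(1) using p(1) m(2) mn(2) by (subst sum_divisors_prime_power_times) (auto simp: mult power)
    have sq: "even e \<and> (\<exists>k. m = k\<^sup>2)" if "n = k\<^sup>2" for k
    proof -
      have k: "k \<noteq> 0" using that less.prems by auto
      have "e = 2 * multiplicity p k"
        unfolding e_def that using p(1) k by (simp add: prime_elem_multiplicity_power_distrib)
      moreover obtain l where "k = p ^ multiplicity p k * l"
        using multiplicity_dvd[of p k] by (auto elim: dvdE)
      ultimately have "p ^ e * m = p ^ e * l\<^sup>2"
        using m(1) that by (metis mult.commute power_mult power_mult_distrib)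
      thus ?thesis using \<open>e = 2 * _\<close> p(1) by (auto simp: prime_gt_0_nat)
    qed
    show ?thesis
      using less.IH[OF mn] geo[of e] sq unfolding r
      by (metis mult_nonneg_nonneg mult_mono' mult_1 zero_le_one)
  qed
qed

end

section \<open>Nonprincipal characters: bounded partial sums and the L-value at 1\<close>

locale nonprincipal_quadratic_character = quadratic_character +
  assumes nonprincipal: "\<exists>n. \<chi> n = -1"
begin

text \<open>Multiplication by some \<open>g\<close> with \<chi>(g) = -1 permutes the residues and
  changes the sign of the sum.\<close>

lemma sum_period: "(\<Sum>n<M. \<chi> n) = 0"
proof -
  obtain g where g: "\<chi> g = -1" using nonprincipal by auto
  hence cop: "coprime g M" using not_coprime[of g] by auto
  have "inj_on (\<lambda>n. g * n mod M) {..<M}"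
  proof (rule inj_onI)
    fix x y assume "x \<in> {..<M}" "y \<in> {..<M}" "g * x mod M = g * y mod M"
    thus "x = y" using cong_mult_lcancel_nat[of g M x y] cop by (auto simp: cong_def coprime_commute)
  qed
  moreover have "(\<lambda>n. g * n mod M) ` {..<M} \<subseteq> {..<M}" using modulus_pos by auto
  ultimately have bij: "bij_betw (\<lambda>n. g * n mod M) {..<M} {..<M}"
    by (simp add: bij_betw_def endo_inj_surj)
  have "(\<Sum>n<M. \<chi> n) = (\<Sum>n<M. \<chi> (g * n mod M))"
    using sum.reindex_bij_betw[OF bij, of \<chi>] by simp
  also have "\<dots> = - (\<Sum>n<M. \<chi> n)"
    by (simp add: periodic mult g sum_negf)
  finally show ?thesis by simp
qed

lemma abs_sum_le: "\<bar>\<Sum>n<N. \<chi> n\<bar> \<le> M"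
proof -
  have step: "(\<Sum>n<N+M. \<chi> n) = (\<Sum>n<N. \<chi> n)" for N
  proof (induction N)
    case (Suc N)
    have "\<chi> (N + M) = \<chi> N" using periodic[of "N + M"] periodic[of N] by simp
    with Suc show ?case by simp
  qed (use sum_period in auto)
  have "(\<Sum>n<N. \<chi> n) = (\<Sum>n<N mod M. \<chi> n)"
  proof (induction N rule: less_induct)
    case (less N)
    show ?case
    proof (cases "N < M")
      case False
      hence "(\<Sum>n<N. \<chi> n) = (\<Sum>n<N-M. \<chi> n)" using step[of "N - M"] by simp
      thus ?thesis using less[of "N - M"] False modulus_pos by (simp add: le_mod_geq)
    qed simp
  qed
  also have "\<bar>\<dots>\<bar> \<le> (\<Sum>n<N mod M. 1)"
    by (intro order.trans[OF sum_abs] sum_mono abs_le_1)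
  also have "\<dots> \<le> real M" using modulus_pos by (simp add: less_imp_le)
  finally show ?thesis .
qed

lemma abs_weighted_sum_le:
  fixes f :: "nat \<Rightarrow> real"
  assumes "\<And>k. m \<le> k \<Longrightarrow> f (Suc k) \<le> f k" "\<And>k. m \<le> k \<Longrightarrow> 0 \<le> f k" "m \<le> n"
  shows "\<bar>\<Sum>k=m..<n. \<chi> k * f k\<bar> \<le> 2 * M * f m"
proof -
  have "\<bar>\<Sum>k=m..<n. \<chi> k * f k\<bar> \<le> 2 * real M * f m"
    by (rule abel_summation_bound) (use abs_sum_le assms in auto)
  thus ?thesis by simp
qed

text \<open>The value L(1, \<chi>); the proof of \<open>L_remainder\<close> shows that the series
  converges. Its term at \<open>k = 0\<close> is 0 by the convention for division.\<close>

definition L where "L = (\<Sum>k. \<chi> k / k)"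

text \<open>Summation by parts against \<open>1 / k\<close> bounds every section starting at
  \<open>m\<close> by \<open>2 * M / m\<close>, which yields both convergence and the rate.\<close>

lemma L_remainder: "\<bar>L - (\<Sum>k=1..N. \<chi> k / k)\<bar> \<le> 2 * M / (N + 1)"
proof -
  define s where "s N = (\<Sum>k<N. \<chi> k / k)" for N
  have diff: "\<bar>s n - s m\<bar> \<le> 2 * M / m" if "0 < m" "m \<le> n" for m n
  proof -
    have "s n - s m = (\<Sum>k=m..<n. \<chi> k * (1 / k))"
      unfolding s_def using that by (subst lessThan_minus_lessThan[symmetric] sum_diff[symmetric]) (auto simp: sum_diff)
    thus ?thesis using abs_weighted_sum_le[of m "\<lambda>k. 1 / real k" n] that by (simp add: field_simps)
  qed
  have "Cauchy s"
  proof (rule metric_CauchyI)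
    fix e :: real assume "e > 0"
    obtain m :: nat where m: "2 * real M / e < m" using reals_Archimedean2 by blast
    hence m0: "m > 0" using \<open>e > 0\<close> by (auto intro!: gr0I simp: field_simps)
    have "dist (s x) (s y) < e" if "m \<le> x" "m \<le> y" for x y
    proof -
      have "dist (s x) (s y) \<le> 2 * M / m" if "m \<le> x" "x \<le> y" for x y
      proof -
        have "dist (s x) (s y) \<le> 2 * M / x" using diff[of x y] m0 that by (simp add: dist_real_def abs_minus_commute)
        also have "\<dots> \<le> 2 * M / m" using m0 that by (intro divide_left_mono) auto
        finally show ?thesis .
      qed
      moreover have "2 * M / m < e" using m m0 \<open>e > 0\<close> by (simp add: field_simps)
      ultimately show ?thesis using that by (metis dist_commute le_less_trans nle_le)
    qed
    thus "\<exists>m. \<forall>x\<ge>m. \<forall>y\<ge>m. dist (s x) (s y) < e" by blast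
  qed
  hence "s \<longlonglongrightarrow> L"
    unfolding L_def s_def by (simp add: summable_LIMSEQ summable_iff_convergent Cauchy_convergent_iff)
  hence "(\<lambda>n. \<bar>s n - s (Suc N)\<bar>) \<longlonglongrightarrow> \<bar>L - s (Suc N)\<bar>"
    by (intro tendsto_intros)
  hence "\<bar>L - s (Suc N)\<bar> \<le> 2 * M / Suc N"
    by (rule LIMSEQ_le_const2) (use diff[of "Suc N"] in \<open>auto intro!: exI[of _ "Suc N"]\<close>)
  moreover have "s (Suc N) = (\<Sum>k=1..N. \<chi> k / k)"
    unfolding s_def by (rule sum.mono_neutral_right) auto
  ultimately show ?thesis by (simp add: add.commute)
qed


text \<open>Summation by parts again. Since \<open>ln k / k\<close> decreases only from
  \<open>k = 3\<close> on, the earlier terms are split off.\<close>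

lemma bounded_sum_ln: "\<bar>\<Sum>n=1..N. \<chi> n * ln n / n\<bar> \<le> 1 + 2 * M"
proof -
  have dec: "ln (Suc k) / Suc k \<le> ln k / k" if "3 \<le> k" for k :: nat
  proof -
    have "ln (1 + 1 / real k) \<le> 1 / k" using that by (intro ln_add_one_self_le_self) auto
    moreover have "ln (real (Suc k) / real k) = ln (Suc k) - ln k" using that by (simp add: ln_divide_pos)
    moreover have "real (Suc k) / real k = 1 + 1 / real k" using that by (simp add: field_simps)
    ultimately have "ln (Suc k) - ln k \<le> 1 / k" by simp
    hence "real k * (ln (Suc k) - ln k) \<le> 1"
      using that by (simp add: field_simps)
    also have "1 \<le> ln (3 :: real)" using exp_le by (simp add: ln_ge_iff)
    also have "\<dots> \<le> ln k" using that by simp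
    finally show ?thesis using that by (simp add: field_simps)
  qed
  have ln3: "ln (3 :: real) / 3 \<le> 1" and ln2: "ln (2 :: real) / 2 \<le> 1"
    using ln_le_minus_one[of "3 :: real"] ln_le_minus_one[of "2 :: real"] by auto
  have two: "\<bar>\<chi> 2 * ln 2 / 2\<bar> \<le> 1"
    using mult_mono[OF abs_le_1[of 2] ln2] by (simp add: abs_mult)
  show ?thesis
  proof (cases "N \<le> 2")
    case True
    hence "N = 0 \<or> N = 1 \<or> N = 2" by auto
    thus ?thesis using two by (auto simp: numeral_2_eq_2)
  next
    case False
    hence "{1..N} = {1, 2} \<union> {3..<Suc N}" by auto
    hence "(\<Sum>n=1..N. \<chi> n * ln n / n) = \<chi> 2 * ln 2 / 2 + (\<Sum>n=3..<Suc N. \<chi> n * (ln n / n))"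
      by (subst \<open>{1..N} = _\<close>, subst sum.union_disjoint) auto
    moreover have "\<bar>\<Sum>n=3..<Suc N. \<chi> n * (ln n / n)\<bar> \<le> 2 * M * (ln (real 3) / real 3)"
      by (rule abs_weighted_sum_le) (use dec False in auto)
    moreover have "2 * M * (ln (real 3) / real 3) \<le> 2 * M"
      using mult_left_mono[OF ln3, of "2 * real M"] by simp
    ultimately show ?thesis using two by linarith
  qed
qed

text \<open>In \<open>sum_ln_convolution\<close> the inner sum is \<open>L\<close> up to an error of
  at most \<open>2 * M * d / N\<close>. By Chebyshev's bound these errors add up to at most
  \<open>8 * M\<close>, and \<open>bounded_sum_ln\<close> supplies the remaining
  \<open>1 + 2 * M\<close>.\<close>

lemma bounded_sum_mangoldt: "\<bar>L * (\<Sum>d=1..N. \<chi> d * mangoldt d / d)\<bar> \<le> 1 + 10 * M"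
proof (cases "N = 0")
  case False
  define R where "R n = L - (\<Sum>k=1..n. \<chi> k / k)" for n
  have "(\<Sum>n=1..N. \<chi> n * ln n / n) = (\<Sum>d=1..N. (\<chi> d * mangoldt d / d) * (L - R (N div d)))"
    unfolding R_def sum_ln_convolution by simp
  also have "\<dots> = L * (\<Sum>d=1..N. \<chi> d * mangoldt d / d) - (\<Sum>d=1..N. \<chi> d * mangoldt d / d * R (N div d))"
    unfolding right_diff_distrib sum_subtractf by (simp add: sum_distrib_left mult.commute)
  finally have "L * (\<Sum>d=1..N. \<chi> d * mangoldt d / d) = (\<Sum>n=1..N. \<chi> n * ln n / n) + (\<Sum>d=1..N. \<chi> d * mangoldt d / d * R (N div d))"
    by simp
  moreover have "\<bar>\<Sum>d=1..N. \<chi> d * mangoldt d / d * R (N div d)\<bar> \<le> (\<Sum>d=1..N. 2 * M / N * mangoldt d)"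
  proof (intro order.trans[OF sum_abs] sum_mono)
    fix d assume d: "d \<in> {1..N}"
    have "N < (N div d + 1) * d" using d dividend_less_div_times[of d N] by simp
    hence "real N \<le> real ((N div d + 1) * d)" by linarith
    hence "real N \<le> (N div d + 1) * real d" by (simp only: of_nat_mult)
    hence "2 * M / (N div d + 1) \<le> 2 * M * d / N"
      using d False mult_left_mono[of "real N" "(N div d + 1) * real d" "2 * real M"] by (simp add: field_simps)
    with L_remainder[of "N div d"] have R: "\<bar>R (N div d)\<bar> \<le> 2 * M * d / N" by (simp add: R_def add.commute)
    have "\<bar>\<chi> d * mangoldt d / d * R (N div d)\<bar> = \<bar>\<chi> d\<bar> * (mangoldt d / d) * \<bar>R (N div d)\<bar>"
      by (simp add: abs_mult)
    also have "\<dots> \<le> 1 * (mangoldt d / d) * (2 * M * d / N)"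
      by (intro mult_mono R abs_le_1 mult_nonneg_nonneg divide_nonneg_nonneg mangoldt_nonneg) auto
    finally show "\<bar>\<chi> d * mangoldt d / d * R (N div d)\<bar> \<le> 2 * M / N * mangoldt d" using d by (simp add: mult_ac)
  qed
  moreover have "(\<Sum>d=1..N. 2 * M / N * mangoldt d) \<le> 2 * M / N * (4 * N)"
    unfolding sum_distrib_left[symmetric] using sum_mangoldt_le[of N] by (intro mult_left_mono) auto
  ultimately show ?thesis using bounded_sum_ln[of N] False by simp
qed auto

end

subsection \<open>Nonvanishing at 1\<close>

text \<open>Pair the terms \<open>j\<close> and \<open>n - 1 - j\<close> and use that a sum of two
  squares is at least twice the product.\<close>

lemma geometric_sum_ge:
  fixes y :: real
  assumes "y \<ge> 0"
  shows "real n * y ^ (n - 1) \<le> (\<Sum>j<n. (y\<^sup>2) ^ j)"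
proof -
  have "2 * (real n * y ^ (n - 1)) = (\<Sum>j<n. 2 * y ^ (n - 1))" by simp
  also have "\<dots> \<le> (\<Sum>j<n. (y ^ j)\<^sup>2 + (y ^ (n - Suc j))\<^sup>2)"
  proof (intro sum_mono)
    fix j assume "j \<in> {..<n}"
    hence "y ^ (n - 1) = y ^ j * y ^ (n - Suc j)" by (simp flip: power_add)
    thus "2 * y ^ (n - 1) \<le> (y ^ j)\<^sup>2 + (y ^ (n - Suc j))\<^sup>2"
      using sum_squares_bound[of "y ^ j" "y ^ (n - Suc j)"] by (simp only: mult.assoc)
  qed
  also have "\<dots> = (\<Sum>j<n. (y\<^sup>2) ^ j) + (\<Sum>j<n. (y\<^sup>2) ^ (n - Suc j))"
    by (simp only: sum.distrib power_mult[symmetric] mult.commute)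
  also have "\<dots> = 2 * (\<Sum>j<n. (y\<^sup>2) ^ j)"
    unfolding sum.nat_diff_reindex by (rule mult_2[symmetric])
  finally show ?thesis by linarith
qed

text \<open>
  The coefficients compare the Lambert series \<open>\<Sum>\<chi>(n)x\<^sup>n/(1 - x\<^sup>n)\<close> with \<open>(1/(1 - x))\<Sum>\<chi>(n)/n\<close>. Since they decrease,
  the difference stays bounded as \<open>x \<rightarrow> 1\<close>, whereas \<open>\<Sum>\<chi>(n)x\<^sup>n/(1 - x\<^sup>n) = \<Sum>r(n)x\<^sup>n\<close> with \<open>r(n) = \<Sum>\<chi>(d)\<close> over \<open>d dvd n\<close>
  is at least \<open>\<Sum>x^(k\<^sup>2)\<close>, which is unbounded (Monsky's argument).
\<close>

lemma lambert_coefficient_props: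
  fixes x :: real and n :: nat
  assumes x: "0 < x" "x < 1" and n: "n > 0"
  defines "b \<equiv> \<lambda>n::nat. 1 / (n * (1 - x)) - x ^ n / (1 - x ^ n)"
  shows "b n \<ge> 0" "b (Suc n) \<le> b n"
proof -
  define g where "g n = (\<Sum>j<n. x ^ j)" for n
  define y where "y = sqrt x"
  have y: "0 < y" "y < 1" "y\<^sup>2 = x" using x by (auto simp: y_def real_sqrt_lt_1_iff)
  have g: "1 - x ^ n = (1 - x) * g n" for n
    unfolding g_def by (rule one_diff_power_eq)
  have g_ge: "g n \<ge> n * y ^ (n - 1)" for n
    using geometric_sum_ge[of y n] y by (simp add: g_def)
  have g_pos: "g n > 0" if "n > 0" for n
    using g_ge[of n] that y by (smt (verit) mult_pos_pos of_nat_0_less_iff zero_less_power)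
  have b: "b n = (1 / n - x ^ n / g n) / (1 - x)" if "n > 0" for n
    unfolding b_def g diff_divide_distrib divide_divide_eq_left by (simp only: mult.commute)
  have "(\<Sum>j<n. x ^ n) \<le> g n"
    unfolding g_def using x by (intro sum_mono power_decreasing) auto
  hence "x ^ n / g n \<le> 1 / n"
    using g_pos[OF n] n by (simp add: pos_divide_le_eq pos_le_divide_eq mult.commute)
  thus "b n \<ge> 0" unfolding b[OF n] using x by simp
  \<comment> \<open>Monotonicity of \<open>b\<close> reduces to this estimate for
    \<open>g n * g (Suc n)\<close>. The two lower bounds \<open>g_ge\<close> multiply to
    \<open>n * (n + 1) * y ^ (2 * n - 1)\<close>, and \<open>y < 1\<close> leaves room for one more
    factor \<open>y\<close>.\<close>
  have "n * (n + 1) * x ^ n = n * (n + 1) * y ^ (2 * n)"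
    by (simp add: power_mult y)
  also have "\<dots> \<le> n * (n + 1) * y ^ ((n - 1) + n)"
    using y by (intro mult_left_mono power_decreasing) auto
  also have "\<dots> = (n * y ^ (n - 1)) * (Suc n * y ^ (Suc n - 1))"
    by (simp add: power_add algebra_simps)
  also have "\<dots> \<le> g n * g (Suc n)"
    using g_ge[of n] g_ge[of "Suc n"] g_pos[OF n] y by (intro mult_mono) (auto simp: less_imp_le)
  finally have *: "n * (n + 1) * x ^ n \<le> g n * g (Suc n)" .
  have "g (Suc n) - x * g n = 1"
    using g[of n] unfolding g_def by (simp add: algebra_simps)
  moreover have "x ^ n * g (Suc n) - x ^ Suc n * g n = x ^ n * (g (Suc n) - x * g n)"
    by (simp add: algebra_simps)
  ultimately have "x ^ n * g (Suc n) - x ^ Suc n * g n = x ^ n" by simp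
  hence "x ^ n / g n - x ^ Suc n / g (Suc n) = x ^ n / (g n * g (Suc n))"
    using g_pos[OF n] g_pos[of "Suc n"] by (simp add: diff_frac_eq)
  also have "\<dots> \<le> 1 / (n * (n + 1))"
  proof -
    have "u / G \<le> 1 / P" if "P * u \<le> G" "P > 0" "G > 0" for u G P :: real
      using that by (simp add: field_simps)
    from this[OF *] show ?thesis using n g_pos[OF n] g_pos[of "Suc n"] by (simp add: add_pos_pos)
  qed
  also have "\<dots> = 1 / n - 1 / Suc n"
    using n by (simp add: field_simps)
  finally show "b (Suc n) \<le> b n"
    unfolding b[OF n] b[OF zero_less_Suc] using x by (intro divide_right_mono) auto
qed

context nonprincipal_quadratic_character begin

lemma L_nonzero: "L \<noteq> 0"
proof
  assume L0: "L = 0"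
  define r where "r n = (\<Sum>d | d dvd n. \<chi> d)" for n
  \<comment> \<open>Chosen so that the lower bound \<open>K / 2\<close> is \<open>2 * M + 2\<close>,
    while the upper bound tends to \<open>2 * M\<close>. With the \<open>x\<close> below,
    Bernoulli's inequality gives x^(K^2) \<ge> 1/2, so each of the \<open>K\<close> squares up to
    K^2 contributes at least 1/2.\<close>
  define K where "K = 4 * M + 4"
  define x :: real where "x = 1 - 1 / (2 * K\<^sup>2)"
  have K: "K \<ge> 1" by (simp add: K_def)
  have "2 * (real K)\<^sup>2 > 1" using K by (smt (verit) of_nat_1 of_nat_mono one_le_power)
  hence x: "0 < x" "x < 1" using K unfolding x_def by (simp_all add: field_simps)
  define b where "b = (\<lambda>n::nat. 1 / (n * (1 - x)) - x ^ n / (1 - x ^ n))"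
  \<comment> \<open>The Lambert series is cut off at \<open>N\<close>. Evaluating the geometric sums
    leaves a partial sum of \<open>L\<close>, small because \<open>L = 0\<close>, a sum against the
    decreasing \<open>b\<close>, and a truncation error.\<close>
  have upper: "(\<Sum>m=1..N. r m * x ^ m) \<le> 2 * M + (1 / (1 - x)) * (2 * M / (N + 1)) + N * x ^ N / (1 - x)" for N :: nat
  proof -
    have "(\<Sum>m=1..N. r m * x ^ m) = (\<Sum>n=1..N. \<Sum>d | d dvd n. \<chi> d * x ^ (d * (n div d)))"
      by (simp add: r_def sum_distrib_right)
    also have "\<dots> = (\<Sum>d=1..N. \<Sum>k=1..N div d. \<chi> d * x ^ (d * k))"
      by (rule sum_divisors_rearrange)
    also have "\<dots> = (\<Sum>d=1..N. (1 / (1 - x)) * (\<chi> d / d) - \<chi> d * b d - \<chi> d * (x ^ (d * (N div d + 1)) / (1 - x ^ d)))"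
    proof (intro sum.cong refl)
      fix d assume d: "d \<in> {1..N}"
      define z where "z = x ^ d"
      have z: "z < 1" using x d by (auto simp: z_def power_Suc_less_one intro: power_less_one_iff[THEN iffD2])
      have zp: "z ^ (N div d + 1) = x ^ (d * (N div d + 1))" by (simp only: z_def power_mult)
      have "(\<Sum>k=1..N div d. x ^ (d * k)) = (\<Sum>k=1..N div d. z ^ k)"
        by (simp add: z_def power_mult)
      also have "\<dots> = (z - z ^ (N div d + 1)) / (1 - z)"
        using z by (subst sum_gp) (auto simp: not_le div_eq_0_iff)
      also have "\<dots> = 1 / (d * (1 - x)) - b d - x ^ (d * (N div d + 1)) / (1 - x ^ d)"
        unfolding zp b_def by (simp add: z_def diff_divide_distrib)
      finally show "(\<Sum>k=1..N div d. \<chi> d * x ^ (d * k)) =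
          (1 / (1 - x)) * (\<chi> d / d) - \<chi> d * b d - \<chi> d * (x ^ (d * (N div d + 1)) / (1 - x ^ d))"
        unfolding sum_distrib_left[symmetric] by (simp only: right_diff_distrib) (simp, simp add: algebra_simps)
    qed
    also have "\<dots> = (1 / (1 - x)) * (\<Sum>d=1..N. \<chi> d / d) - (\<Sum>d=1..<Suc N. \<chi> d * b d)
        - (\<Sum>d=1..N. \<chi> d * (x ^ (d * (N div d + 1)) / (1 - x ^ d)))"
      by (simp add: sum_subtractf sum_distrib_left atLeastLessThanSuc_atLeastAtMost)
    also have "\<dots> \<le> (1 / (1 - x)) * (2 * M / (N + 1)) + 2 * M + N * x ^ N / (1 - x)"
    proof -
      have "(\<Sum>d=1..N. \<chi> d / d) \<le> 2 * M / (N + 1)" using L_remainder[of N] L0 by (simp add: add.commute abs_le_iff)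
      hence 1: "(1 / (1 - x)) * (\<Sum>d=1..N. \<chi> d / d) \<le> (1 / (1 - x)) * (2 * M / (N + 1))"
        using x by (intro mult_left_mono) auto
      have "\<bar>\<Sum>d=1..<Suc N. \<chi> d * b d\<bar> \<le> 2 * M * b 1"
        by (rule abs_weighted_sum_le) (use lambert_coefficient_props[OF x] in \<open>auto simp: b_def\<close>)
      also have "b 1 = 1" using x by (simp add: b_def field_simps)
      finally have 2: "- (\<Sum>d=1..<Suc N. \<chi> d * b d) \<le> 2 * M" by simp
      have "\<bar>\<Sum>d=1..N. \<chi> d * (x ^ (d * (N div d + 1)) / (1 - x ^ d))\<bar> \<le> (\<Sum>d=1..N. x ^ N / (1 - x))"
      proof (intro order.trans[OF sum_abs] sum_mono)
        fix d assume d: "d \<in> {1..N}"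
        have xd: "x ^ d \<le> x" using d x power_decreasing[of 1 d x] by simp
        have "N \<le> d * (N div d + 1)" using d dividend_less_div_times[of d N] by (simp add: mult.commute less_imp_le)
        hence "x ^ (d * (N div d + 1)) / (1 - x ^ d) \<le> x ^ N / (1 - x)"
          using x xd by (intro frac_le power_decreasing) auto
        moreover have "0 \<le> x ^ (d * (N div d + 1)) / (1 - x ^ d)" using x xd by simp
        ultimately show "\<bar>\<chi> d * (x ^ (d * (N div d + 1)) / (1 - x ^ d))\<bar> \<le> x ^ N / (1 - x)"
          by (rule abs_mult_le[rotated])
      qed
      hence 3: "- (\<Sum>d=1..N. \<chi> d * (x ^ (d * (N div d + 1)) / (1 - x ^ d))) \<le> N * x ^ N / (1 - x)" by simp
      from 1 2 3 show ?thesis by linarith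
    qed
    finally show ?thesis by simp
  qed
  have lower: "real K / 2 \<le> (\<Sum>m=1..N. r m * x ^ m)" if "N \<ge> K\<^sup>2" for N
  proof -
    have "(\<Sum>k=1..K. 1 / 2) \<le> (\<Sum>k=1..K. r (k\<^sup>2) * x ^ k\<^sup>2)"
    proof (intro sum_mono)
      fix k assume k: "k \<in> {1..K}"
      have "1 / 2 \<le> 1 + real (K\<^sup>2) * (- 1 / (2 * K\<^sup>2))" using K by simp
      also have "\<dots> \<le> (1 + - 1 / (2 * K\<^sup>2)) ^ K\<^sup>2"
        using x unfolding x_def by (intro Bernoulli_inequality) auto
      also have "\<dots> = x ^ K\<^sup>2" by (simp add: x_def)
      also have "\<dots> \<le> x ^ k\<^sup>2" using x k by (intro power_decreasing) (auto intro: power_mono)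
      also have "\<dots> \<le> r (k\<^sup>2) * x ^ k\<^sup>2"
        using sum_divisors_nonneg_ge_1[of "k\<^sup>2"] k x by (auto simp: r_def intro!: mult_le_cancel_right1[THEN iffD2])
      finally show "1 / 2 \<le> r (k\<^sup>2) * x ^ k\<^sup>2" .
    qed
    also have "\<dots> = (\<Sum>m\<in>(\<lambda>k. k\<^sup>2) ` {1..K}. r m * x ^ m)"
      by (subst sum.reindex) (auto simp: inj_on_def)
    also have "\<dots> \<le> (\<Sum>m=1..N. r m * x ^ m)"
    proof (rule sum_mono2)
      show "(\<lambda>k. k\<^sup>2) ` {1..K} \<subseteq> {1..N}"
        using that by (auto intro: order.trans[OF power_mono])
      show "0 \<le> r m * x ^ m" if "m \<in> {1..N} - (\<lambda>k. k\<^sup>2) ` {1..K}" for m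
        using sum_divisors_nonneg_ge_1[of m] that x by (auto simp: r_def)
    qed auto
    finally show ?thesis by simp
  qed
  \<comment> \<open>Here \<open>x\<close> is fixed, so the error terms vanish as \<open>N\<close>
    grows.\<close>
  have "(\<lambda>N. (1 / (1 - x)) * (2 * M / (real N + 1)) + real N * x ^ N / (1 - x)) \<longlonglongrightarrow> (1 / (1 - x)) * 0 + 0 / (1 - x)"
  proof (intro tendsto_intros)
    show "(\<lambda>N. 2 * M / (real N + 1)) \<longlonglongrightarrow> 0"
      using tendsto_mult_right_zero[OF LIMSEQ_inverse_real_of_nat, of "2 * real M"] by (simp add: field_simps)
    show "(\<lambda>N. real N * x ^ N) \<longlonglongrightarrow> 0" using powser_times_n_limit_0[of x] x by simp
  qed (use x in auto)
  hence "\<forall>\<^sub>F N in sequentially. (1 / (1 - x)) * (2 * M / (real N + 1)) + real N * x ^ N / (1 - x) < 1"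
    by (intro order_tendstoD) auto
  from eventually_happens'[OF sequentially_bot eventually_conj[OF eventually_ge_at_top[of "K\<^sup>2"] this]]
  obtain N where "N \<ge> K\<^sup>2" "(1 / (1 - x)) * (2 * M / (real N + 1)) + real N * x ^ N / (1 - x) < 1"
    by auto
  with upper[of N] lower[of N] show False by (simp add: K_def add.commute[of 1])
qed

lemma bounded_mangoldt: "\<exists>B. \<forall>N. \<bar>\<Sum>d=1..N. \<chi> d * mangoldt d / d\<bar> \<le> B"
proof -
  have "\<bar>\<Sum>d=1..N. \<chi> d * mangoldt d / d\<bar> \<le> (1 + 10 * M) / \<bar>L\<bar>" for N
    using bounded_sum_mangoldt[of N] L_nonzero by (simp add: abs_mult field_simps)
  thus ?thesis by blast
qed

end

subsection \<open>Primes in a class modulo squares\<close>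

text \<open>Let \<open>B\<close> bound these sums and let \<open>H\<close> be the partial sums of
  \<chi>(k)/k. Beyond \<open>y\<close> one has \<open>ln n \<ge> B + 1\<close>, so
  \<open>sum_ln_convolution\<close> gives \<open>(B + 1) * (H N - H y) \<le> B * H N\<close>. This
  bounds \<open>H\<close>, against the divergence of the harmonic series.\<close>

lemma (in quadratic_character) unbounded_mangoldt:
  assumes principal: "\<And>n. \<chi> n \<noteq> -1"
  shows "\<exists>N. B < (\<Sum>d=1..N. \<chi> d * mangoldt d / d)"
proof (rule ccontr)
  assume "\<nexists>N. B < (\<Sum>d=1..N. \<chi> d * mangoldt d / d)"
  hence le: "(\<Sum>d=1..N. \<chi> d * mangoldt d / d) \<le> B" for N by (auto simp: not_less)
  from le[of 0] have B0: "B \<ge> 0" by simp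
  have nonneg: "\<chi> n \<ge> 0" for n using principal[of n] coprime[of n] not_coprime[of n] by (cases "Rings.coprime n M") auto
  define H where "H N = (\<Sum>k=1..N. \<chi> k / k)" for N
  have H_mono: "H m \<le> H n" if "m \<le> n" for m n
    unfolding H_def using that nonneg by (intro sum_mono2) auto
  define y where "y = nat \<lceil>exp (B + 1)\<rceil>"
  have "exp (B + 1) \<le> y" unfolding y_def by linarith
  hence y: "y \<ge> 1" "ln y \<ge> B + 1"
    using exp_gt_zero[of "B + 1"] by (auto simp: ln_ge_iff Suc_le_eq simp del: exp_gt_zero intro!: gr0I)
  have bound: "H N \<le> (B + 1) * H y" if "N \<ge> y" for N
  proof -
    have "(B + 1) * (H N - H y) = (\<Sum>n=y+1..N. (B + 1) * (\<chi> n / n))"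
    proof -
      have "{1..N} = {1..y} \<union> {y+1..N}" using that by auto
      hence "H N = H y + (\<Sum>n=y+1..N. \<chi> n / n)" unfolding H_def by (simp add: sum.union_disjoint)
      thus ?thesis by (simp add: sum_distrib_left)
    qed
    also have "\<dots> \<le> (\<Sum>n=y+1..N. \<chi> n * ln n / n)"
    proof (intro sum_mono)
      fix n assume "n \<in> {y+1..N}"
      hence "ln y \<le> ln n" using y by (subst ln_le_cancel_iff) auto
      hence "(\<chi> n / n) * (B + 1) \<le> (\<chi> n / n) * ln n" using y nonneg by (intro mult_left_mono) auto
      thus "(B + 1) * (\<chi> n / n) \<le> \<chi> n * ln n / n" by (simp add: mult.commute)
    qed
    also have "\<dots> \<le> (\<Sum>n=1..N. \<chi> n * ln n / n)"
      using nonneg y by (intro sum_mono2) auto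
    also have "\<dots> = (\<Sum>d=1..N. (\<chi> d * mangoldt d / d) * H (N div d))"
      unfolding H_def by (rule sum_ln_convolution)
    also have "\<dots> \<le> (\<Sum>d=1..N. (\<chi> d * mangoldt d / d) * H N)"
      using nonneg by (intro sum_mono mult_left_mono H_mono divide_nonneg_nonneg mult_nonneg_nonneg mangoldt_nonneg) auto
    also have "\<dots> \<le> B * H N"
      unfolding sum_distrib_right[symmetric] using le nonneg
      by (intro mult_right_mono) (auto simp: H_def intro!: sum_nonneg)
    finally show ?thesis by (simp add: algebra_simps)
  qed
  have "summable (\<lambda>k. \<chi> k / k)"
  proof (rule bounded_imp_summable)
    fix N
    have "(\<Sum>k\<le>N. \<chi> k / k) = H N" unfolding H_def by (rule sum.mono_neutral_right) auto
    also have "\<dots> \<le> H (max N y)" by (rule H_mono) simp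
    also have "\<dots> \<le> (B + 1) * H y" by (rule bound) simp
    finally show "(\<Sum>k\<le>N. \<chi> k / k) \<le> (B + 1) * H y" .
  qed (use nonneg in auto)
  \<comment> \<open>The subseries over k = jM + 1, where \<chi> is 1, dominates the harmonic series
    divided by \<open>M\<close>.\<close>
  hence "summable ((\<lambda>k. \<chi> k / k) \<circ> (\<lambda>j. j * M + 1))"
    by (rule summable_reindex) (use nonneg modulus_pos in \<open>auto simp: inj_on_def\<close>)
  moreover have "\<chi> (j * M + 1) = 1" for j
    using periodic one mod_mult_self3[of j M 1] by metis
  ultimately have "summable (\<lambda>j. 1 / real (j * M + 1))" by (simp add: comp_def)
  hence "summable (\<lambda>j. M * (1 / real (j * M + 1)))" by (rule summable_mult)
  moreover have "norm (inverse (real (Suc j))) \<le> M * (1 / real (j * M + 1))" for j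
  proof -
    have "j * M + 1 \<le> M * Suc j" using modulus_pos by simp
    hence "real (j * M + 1) \<le> M * real (Suc j)" by (metis of_nat_le_iff of_nat_mult)
    moreover have "1 / q \<le> m * (1 / r)" if "r \<le> m * q" "q > 0" "r > 0" for q r m :: real
      using that by (simp add: field_simps)
    ultimately show ?thesis by (simp add: inverse_eq_divide del: of_nat_Suc of_nat_add of_nat_mult)
  qed
  ultimately have summable: "summable (\<lambda>j. inverse (real (Suc j)))"
    by (rule summable_comparison_test'[where N = 0])
  have ln_le: "ln (real (n + 1)) \<le> (\<Sum>j<n. inverse (real (Suc j)))" for n
  proof (induction n)
    case (Suc n)
    have "ln (real (n + 2) / real (n + 1)) \<le> real (n + 2) / real (n + 1) - 1"
      by (intro ln_le_minus_one) auto
    also have "\<dots> = inverse (real (Suc n))" by (simp add: field_simps)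
    finally show ?case using Suc by (simp add: ln_div)
  qed simp
  obtain n where n: "exp (\<Sum>j. inverse (real (Suc j))) < real n" using reals_Archimedean2 by blast
  have "ln (real (n + 1)) \<le> (\<Sum>j. inverse (real (Suc j)))"
    by (intro order.trans[OF ln_le sum_le_suminf[OF summable]]) auto
  hence "exp (ln (real (n + 1))) \<le> exp (\<Sum>j. inverse (real (Suc j)))" by (simp only: exp_le_cancel_iff)
  with n show False by simp
qed

section \<open>The group of real characters modulo \<open>M\<close> and the separation of
  nonsquares\<close>

lemma quadratic_character_mult:
  assumes "quadratic_character M \<chi>" "quadratic_character M \<psi>"
  shows "quadratic_character M (\<lambda>n. \<psi> n * \<chi> n)"
proof -
  interpret \<chi>: quadratic_character M \<chi> by fact
  interpret \<psi>: quadratic_character M \<psi> by fact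
  show ?thesis
  proof
    fix n assume "coprime n M"
    thus "\<psi> n * \<chi> n = 1 \<or> \<psi> n * \<chi> n = - 1" using \<chi>.coprime[of n] \<psi>.coprime[of n] by auto
  qed (use \<chi>.modulus_pos \<chi>.not_coprime in \<open>auto simp: \<chi>.mult \<psi>.mult \<chi>.periodic \<psi>.periodic\<close>)
qed

lemma quadratic_character_principal:
  assumes "M > 0"
  shows "quadratic_character M (\<lambda>n. if coprime n M then 1 else 0)"
  by standard (use assms in auto)

lemma finite_quadratic_characters: "finite {\<chi>. quadratic_character M \<chi>}"
proof (rule finite_imageD)
  show "finite ((\<lambda>\<chi>. restrict \<chi> {..<M}) ` {\<chi>. quadratic_character M \<chi>})"
  proof (rule finite_subset)
    show "(\<lambda>\<chi>. restrict \<chi> {..<M}) ` {\<chi>. quadratic_character M \<chi>} \<subseteq> PiE {..<M} (\<lambda>_. {-1, 0, 1 :: real})"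
    proof (clarify, rule PiE_I)
      fix \<chi> n assume "quadratic_character M \<chi>" "n \<in> {..<M}"
      thus "restrict \<chi> {..<M} n \<in> {-1, 0, 1}"
        using quadratic_character.coprime[of M \<chi> n] quadratic_character.not_coprime[of M \<chi> n]
        by (cases "coprime n M") auto
    qed auto
  qed (intro finite_PiE, auto)
  show "inj_on (\<lambda>\<chi>. restrict \<chi> {..<M}) {\<chi>. quadratic_character M \<chi>}"
  proof (rule inj_onI, clarify, rule ext)
    fix \<chi> \<psi> n assume eq: "restrict \<chi> {..<M} = restrict \<psi> {..<M}"
      and \<chi>: "quadratic_character M \<chi>" and \<psi>: "quadratic_character M \<psi>"
    have "n mod M \<in> {..<M}" using quadratic_character.modulus_pos[OF \<chi>] by simp
    hence "\<chi> (n mod M) = \<psi> (n mod M)" using eq by (metis restrict_apply')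
    thus "\<chi> n = \<psi> n" using quadratic_character.periodic \<chi> \<psi> by metis
  qed
qed

text \<open>
  A subgroup that is maximal among those containing all squares and avoiding \<open>n\<close> has index 2.
\<close>

lemma exists_quadratic_character_neg:
  fixes M n :: nat
  assumes M: "M > 0" and n: "coprime n M" and nsq: "\<nexists>s. [s\<^sup>2 = n] (mod M)"
  shows "\<exists>\<chi>. quadratic_character M \<chi> \<and> \<chi> n = -1"
proof -
  \<comment> \<open>Subgroups of the units modulo \<open>M\<close> that contain the squares and
    avoid \<open>n\<close>, encoded as unions of residue classes. Closure under inverses follows:
    the inverse of an element is the element times the square of its inverse.\<close>
  define good where "good H \<longleftrightarrow> (\<forall>a\<in>H. coprime a M) \<and> (\<forall>a\<in>H. \<forall>b. [a = b] (mod M) \<longrightarrow> b \<in> H) \<and>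
    (\<forall>a\<in>H. \<forall>b\<in>H. a * b \<in> H) \<and> (\<forall>s. coprime s M \<longrightarrow> s\<^sup>2 \<in> H) \<and> n \<notin> H" for H :: "nat set"
  define Q where "Q = {a. coprime a M \<and> (\<exists>s. [s\<^sup>2 = a] (mod M))}"
  have good_Q: "good Q"
    unfolding good_def
  proof (intro conjI ballI allI impI)
    show "coprime a M" if "a \<in> Q" for a using that by (simp add: Q_def)
    show "b \<in> Q" if "a \<in> Q" "[a = b] (mod M)" for a b
      using that unfolding Q_def by (auto intro: cong_trans dest: cong_imp_coprime)
    show "a * b \<in> Q" if "a \<in> Q" "b \<in> Q" for a b
    proof -
      from that obtain s t where "[s\<^sup>2 = a] (mod M)" "[t\<^sup>2 = b] (mod M)" by (auto simp: Q_def)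
      hence "[(s * t)\<^sup>2 = a * b] (mod M)" unfolding power_mult_distrib by (rule cong_mult)
      with that show ?thesis by (auto simp: Q_def)
    qed
    show "s\<^sup>2 \<in> Q" if "coprime s M" for s using that by (auto simp: Q_def intro!: exI[of _ s])
    show "n \<notin> Q" using nsq by (auto simp: Q_def)
  qed
  have "\<exists>H\<in>{H. good H}. \<forall>X\<in>{H. good H}. H \<subseteq> X \<longrightarrow> X = H"
  proof (rule subset_Zorn_nonempty)
    fix C assume "C \<noteq> {}" and "subset.chain {H. good H} C"
    hence C: "\<And>H. H \<in> C \<Longrightarrow> good H" "\<And>H K. H \<in> C \<Longrightarrow> K \<in> C \<Longrightarrow> H \<subseteq> K \<or> K \<subseteq> H"
      by (auto simp: subset_chain_def)
    show "\<Union>C \<in> {H. good H}"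
      unfolding mem_Collect_eq good_def
    proof (intro conjI ballI allI impI)
      show "a * b \<in> \<Union>C" if ab: "a \<in> \<Union>C" "b \<in> \<Union>C" for a b
      proof -
        from ab obtain H K where "H \<in> C" "K \<in> C" "a \<in> H" "b \<in> K" by auto
        with C(2) obtain X where "X \<in> C" "a \<in> X" "b \<in> X" by blast
        thus ?thesis using C(1)[of X] unfolding good_def by blast
      qed
      show "s\<^sup>2 \<in> \<Union>C" if "coprime s M" for s
        using that \<open>C \<noteq> {}\<close> C(1) unfolding good_def by blast
    qed (use C(1) in \<open>unfold good_def, blast\<close>)+
  qed (use good_Q in auto)
  then obtain H where H: "good H" and max: "\<And>X. good X \<Longrightarrow> H \<subseteq> X \<Longrightarrow> X = H" by blast
  have H_coprime: "coprime a M" if "a \<in> H" for a using H that by (auto simp: good_def)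
  have H_cong: "b \<in> H" if "a \<in> H" "[a = b] (mod M)" for a b using H that by (auto simp: good_def)
  have H_mult: "a * b \<in> H" if "a \<in> H" "b \<in> H" for a b using H that by (auto simp: good_def)
  have H_square: "s\<^sup>2 \<in> H" if "coprime s M" for s using H that by (auto simp: good_def)
  have n_H: "n \<notin> H" using H by (auto simp: good_def)
  have cancel: "y \<in> H" if xy: "x\<^sup>2 * y \<in> H" and x: "coprime x M" for x y
  proof -
    obtain i where i: "[x * i = 1] (mod M)" using x cong_solve_coprime_nat by auto
    hence "coprime i M" by (metis cong_imp_coprime cong_sym coprime_1_left coprime_mult_left_iff)
    hence "x\<^sup>2 * y * i\<^sup>2 \<in> H" by (intro H_mult[OF xy] H_square)
    moreover have "[x\<^sup>2 * y * i\<^sup>2 = y] (mod M)"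
      using cong_mult[OF cong_pow[OF i, of 2] cong_refl[of y]] by (simp add: power_mult_distrib mult_ac)
    ultimately show ?thesis by (rule H_cong)
  qed
  \<comment> \<open>Otherwise the union of \<open>H\<close> and its coset by \<open>g\<close> is a
    larger good set. Thus \<open>n\<close> lies in every coset other than \<open>H\<close>, so there
    is only one.\<close>
  have coset: "\<exists>h\<in>H. [n = g * h] (mod M)" if g: "coprime g M" "g \<notin> H" for g
  proof (rule ccontr)
    assume contra: "\<not> (\<exists>h\<in>H. [n = g * h] (mod M))"
    define X where "X = H \<union> {x. \<exists>h\<in>H. [x = g * h] (mod M)}"
    have "good X"
      unfolding good_def
    proof (intro conjI ballI allI impI)
      show "coprime a M" if "a \<in> X" for a
        using that g H_coprime unfolding X_def
        by (auto dest!: cong_sym[of a] dest: cong_imp_coprime)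
      show "b \<in> X" if "a \<in> X" "[a = b] (mod M)" for a b
        using that H_cong cong_trans[OF cong_sym[OF that(2)]] unfolding X_def by blast
      have left: "a * b \<in> X" if "a \<in> H" "[b = g * h] (mod M)" "h \<in> H" for a b h
      proof -
        have "[a * b = g * (a * h)] (mod M)" using cong_mult[OF cong_refl[of a] that(2)] by (simp add: mult_ac)
        thus ?thesis using H_mult[OF that(1,3)] unfolding X_def by blast
      qed
      have right: "a * b \<in> X" if "[a = g * k] (mod M)" "k \<in> H" "[b = g * h] (mod M)" "h \<in> H" for a b h k
      proof -
        have "[a * b = g\<^sup>2 * (k * h)] (mod M)"
          using cong_mult[OF that(1,3)] by (simp add: mult_ac power2_eq_square)
        moreover have "g\<^sup>2 * (k * h) \<in> H" using that g by (intro H_mult H_square)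
        ultimately show ?thesis using H_cong cong_sym unfolding X_def by blast
      qed
      show "a * b \<in> X" if ab: "a \<in> X" "b \<in> X" for a b
      proof -
        consider "a \<in> H" "b \<in> H" | h where "a \<in> H" "[b = g * h] (mod M)" "h \<in> H"
          | h where "b \<in> H" "[a = g * h] (mod M)" "h \<in> H"
          | h k where "[a = g * k] (mod M)" "k \<in> H" "[b = g * h] (mod M)" "h \<in> H"
          using ab unfolding X_def by blast
        thus ?thesis
        proof cases
          case 1
          thus ?thesis using H_mult by (simp add: X_def)
        next
          case (2 h)
          thus ?thesis by (rule left)
        next
          case (3 h)
          thus ?thesis using left[of b a h] by (simp add: mult.commute)
        next
          case (4 h k)
          thus ?thesis by (rule right)
        qed
      qed
      show "s\<^sup>2 \<in> X" if "coprime s M" for s using H_square[OF that] by (simp add: X_def)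
      show "n \<notin> X" using contra n_H by (auto simp: X_def)
    qed
    moreover have "H \<subseteq> X" by (auto simp: X_def)
    ultimately have "X = H" by (rule max)
    moreover have "g \<in> X" using H_square[of 1] unfolding X_def by (auto intro!: bexI[of _ 1])
    ultimately show False using g by simp
  qed
  define \<chi> where "\<chi> k = (if \<not> coprime k M then 0 else if k \<in> H then 1 else -1 :: real)" for k
  have mixed: "x * y \<notin> H" if "x \<in> H" "y \<notin> H" for x y
  proof
    assume "x * y \<in> H"
    hence "x\<^sup>2 * y \<in> H" using H_mult[OF that(1)] by (simp add: power2_eq_square mult.assoc)
    thus False using cancel H_coprime that by blast
  qed
  \<comment> \<open>Both elements lie in the coset of \<open>n\<close>, so their product is
    congruent to an element of \<open>H\<close> up to squares.\<close>
  have both: "x * y \<in> H" if "coprime x M" "x \<notin> H" "coprime y M" "y \<notin> H" for x y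
  proof -
    from coset[OF that(1,2)] coset[OF that(3,4)]
    obtain h k where h: "h \<in> H" "[n = x * h] (mod M)" and k: "k \<in> H" "[n = y * k] (mod M)"
      by blast
    have "[n * n * (h * k) = (x * h) * (y * k) * (h * k)] (mod M)" by (intro cong_mult h k cong_refl)
    hence "[n\<^sup>2 * (h * k) = (h * k)\<^sup>2 * (x * y)] (mod M)" by (simp add: power2_eq_square mult_ac)
    moreover have "n\<^sup>2 * (h * k) \<in> H" using h k n by (intro H_mult H_square)
    ultimately have "(h * k)\<^sup>2 * (x * y) \<in> H" using H_cong by blast
    thus ?thesis by (rule cancel) (use h k in \<open>simp add: H_coprime\<close>)
  qed
  have "quadratic_character M \<chi>"
  proof
    show "\<chi> (x * y) = \<chi> x * \<chi> y" for x y
      using mixed[of x y] mixed[of y x] both[of x y] H_mult[of x y]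
      by (auto simp: \<chi>_def mult.commute)
    show "\<chi> (k mod M) = \<chi> k" for k
    proof -
      have "[k mod M = k] (mod M)" by (simp add: cong_def)
      hence "coprime (k mod M) M \<longleftrightarrow> coprime k M" "k mod M \<in> H \<longleftrightarrow> k \<in> H"
        using H_cong cong_sym cong_imp_coprime by blast+
      thus ?thesis by (simp add: \<chi>_def)
    qed
  qed (use M in \<open>auto simp: \<chi>_def\<close>)
  moreover have "\<chi> n = -1" using n n_H by (simp add: \<chi>_def)
  ultimately show ?thesis by blast
qed

text \<open>If there were no such prime, \<open>c * p ^ k\<close> would never be a square for
  \<open>p\<close> coprime to \<open>M\<close>: even \<open>k\<close> would make \<open>c\<close> a
  square, odd \<open>k\<close> would make \<open>c\<close> equal to \<open>p\<close> times a square.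
  By orthogonality the sums over prime powers, weighted with \<chi>(c), would cancel over all
  characters; but only the principal one is unbounded.\<close>

lemma exists_prime_times_square_cong:
  fixes M c :: nat
  assumes M: "M > 0" and c: "coprime c M" and nsq: "\<nexists>s. [s\<^sup>2 = c] (mod M)"
  shows "\<exists>p A. prime p \<and> coprime p M \<and> [p * A\<^sup>2 = c] (mod M)"
proof (rule ccontr)
  assume none: "\<not> ?thesis"
  define X where "X = {\<chi>. quadratic_character M \<chi>}"
  have fin: "finite X" unfolding X_def by (rule finite_quadratic_characters)
  define \<chi>0 :: "nat \<Rightarrow> real" where "\<chi>0 n = (if coprime n M then 1 else 0)" for n
  have \<chi>0: "\<chi>0 \<in> X" using quadratic_character_principal[OF M] by (simp add: X_def \<chi>0_def[abs_def])
  have orth: "(\<Sum>\<chi>\<in>X. \<chi> n) = 0" if n: "coprime n M" "\<nexists>s. [s\<^sup>2 = n] (mod M)" for n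
  proof -
    obtain \<psi> where \<psi>: "quadratic_character M \<psi>" "\<psi> n = -1"
      using exists_quadratic_character_neg[OF M n] by blast
    \<comment> \<open>Multiplication by \<psi> is an involution of the set of characters, and it
      negates the sum because \<psi>(n) = -1.\<close>
    have "\<psi> k * (\<psi> k * \<chi> k) = \<chi> k" if "\<chi> \<in> X" for \<chi> k
      using that \<psi>(1) quadratic_character.coprime[of M \<psi> k] quadratic_character.not_coprime[of M \<chi> k]
      unfolding X_def by (cases "coprime k M") auto
    hence "(\<Sum>\<chi>\<in>X. \<chi> n) = (\<Sum>\<chi>\<in>X. \<psi> n * \<chi> n)"
      using quadratic_character_mult \<psi>(1)
      by (intro sum.reindex_bij_witness[of _ "\<lambda>\<chi> k. \<psi> k * \<chi> k" "\<lambda>\<chi> k. \<psi> k * \<chi> k"]) (auto simp: X_def)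
    thus ?thesis using \<psi>(2) by (simp add: sum_negf)
  qed
  have not_square: "\<nexists>s. [s\<^sup>2 = c * p ^ k] (mod M)" if p: "prime p" "coprime p M" for p k
  proof
    assume "\<exists>s. [s\<^sup>2 = c * p ^ k] (mod M)"
    then obtain s where s: "[s\<^sup>2 = c * p ^ k] (mod M)" by blast
    \<comment> \<open>Half of \<open>k\<close> rounded up, so that \<open>p ^ (2 * j)\<close> is
      \<open>p ^ k\<close> or \<open>p ^ (k + 1)\<close>; \<open>i\<close> inverts
      \<open>p ^ j\<close>.\<close>
    define j where "j = (k + 1) div 2"
    obtain i where "[p ^ j * i = 1] (mod M)"
      using p cong_solve_coprime_nat[of "p ^ j" M] by auto
    hence i: "[p ^ (2 * j) * i\<^sup>2 = 1] (mod M)"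
      using cong_pow[of "p ^ j * i" 1 M 2] by (simp add: power_mult_distrib power_mult mult.commute)
    show False
    proof (cases "even k")
      case True
      hence "k = 2 * j" by (auto simp: j_def)
      hence "[s\<^sup>2 * i\<^sup>2 = c * (p ^ (2 * j) * i\<^sup>2)] (mod M)"
        using cong_mult[OF s cong_refl[of "i\<^sup>2"]] by (simp add: mult_ac)
      also have "[c * (p ^ (2 * j) * i\<^sup>2) = c * 1] (mod M)" by (intro cong_mult cong_refl i)
      finally have "[(s * i)\<^sup>2 = c] (mod M)" by (simp add: power_mult_distrib)
      thus False using nsq by blast
    next
      case False
      hence "k + 1 = 2 * j" by (auto simp: j_def)
      hence pk: "p * p ^ k = p ^ (2 * j)" by (metis Suc_eq_plus1 power_Suc)
      have "[p * (s * i)\<^sup>2 = c * (p * p ^ k * i\<^sup>2)] (mod M)"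
        using cong_mult[OF s cong_refl[of "p * i\<^sup>2"]] by (simp add: mult_ac power_mult_distrib)
      also have "[c * (p * p ^ k * i\<^sup>2) = c * 1] (mod M)"
        unfolding pk by (intro cong_mult cong_refl i)
      finally have "[p * (s * i)\<^sup>2 = c] (mod M)" by simp
      thus False using none p by blast
    qed
  qed
  have vanish: "(\<Sum>\<chi>\<in>X. \<chi> c * (\<Sum>d=1..N. \<chi> d * mangoldt d / d)) = 0" for N
  proof -
    have "(\<Sum>\<chi>\<in>X. \<chi> c * (\<Sum>d=1..N. \<chi> d * mangoldt d / d)) = (\<Sum>\<chi>\<in>X. \<Sum>d=1..N. \<chi> (c * d) * (mangoldt d / d))"
      by (intro sum.cong refl) (simp add: X_def quadratic_character.mult sum_distrib_left mult.assoc)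
    also have "\<dots> = (\<Sum>d=1..N. (\<Sum>\<chi>\<in>X. \<chi> (c * d)) * (mangoldt d / d))"
      unfolding sum_distrib_right by (rule sum.swap)
    also have "\<dots> = 0"
    proof (intro sum.neutral ballI)
      fix d
      show "(\<Sum>\<chi>\<in>X. \<chi> (c * d)) * (mangoldt d / real d) = 0"
      proof (cases "primepow d \<and> coprime d M")
        case True
        then obtain p k where pk: "prime p" "k > 0" "d = p ^ k" by (auto simp: primepow_def)
        hence "coprime p M" using True by simp
        with pk True c have "(\<Sum>\<chi>\<in>X. \<chi> (c * d)) = 0"
          by (intro orth) (auto simp: not_square)
        thus ?thesis by simp
      next
        case False
        thus ?thesis
        proof (cases "primepow d")
          case True
          with False have "\<not> coprime (c * d) M" by simp
          hence "(\<Sum>\<chi>\<in>X. \<chi> (c * d)) = 0"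
            by (intro sum.neutral) (auto simp: X_def quadratic_character.not_coprime)
          thus ?thesis by simp
        qed (simp add: mangoldt_def)
      qed
    qed
    finally show ?thesis .
  qed
  have "\<forall>\<chi>\<in>X - {\<chi>0}. \<exists>B. \<forall>N. \<bar>\<chi> c * (\<Sum>d=1..N. \<chi> d * mangoldt d / d)\<bar> \<le> B"
  proof
    fix \<chi> assume \<chi>: "\<chi> \<in> X - {\<chi>0}"
    interpret quadratic_character M \<chi> using \<chi> by (simp add: X_def)
    have "\<exists>n. \<chi> n = -1"
    proof (rule ccontr)
      assume "\<nexists>n. \<chi> n = -1"
      hence "\<chi> = \<chi>0" using coprime not_coprime by (auto simp: \<chi>0_def fun_eq_iff)
      with \<chi> show False by simp
    qed
    then interpret nonprincipal_quadratic_character M \<chi> by unfold_locales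
    obtain B where "\<And>N. \<bar>\<Sum>d=1..N. \<chi> d * mangoldt d / d\<bar> \<le> B" using bounded_mangoldt by blast
    hence "\<bar>\<chi> c * (\<Sum>d=1..N. \<chi> d * mangoldt d / d)\<bar> \<le> 1 * B" for N
      unfolding abs_mult by (intro mult_mono abs_le_1) auto
    thus "\<exists>B. \<forall>N. \<bar>\<chi> c * (\<Sum>d=1..N. \<chi> d * mangoldt d / d)\<bar> \<le> B" by blast
  qed
  from bchoice[OF this]
  obtain B where B: "\<forall>\<chi>\<in>X - {\<chi>0}. \<forall>N. \<bar>\<chi> c * (\<Sum>d=1..N. \<chi> d * mangoldt d / d)\<bar> \<le> B \<chi>" ..
  obtain N where "(\<Sum>\<chi>\<in>X-{\<chi>0}. B \<chi>) < (\<Sum>d=1..N. \<chi>0 d * mangoldt d / d)"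
  proof -
    have "\<chi>0 n \<noteq> -1" for n by (simp add: \<chi>0_def)
    thus ?thesis using quadratic_character.unbounded_mangoldt[of M \<chi>0] \<chi>0 that unfolding X_def by blast
  qed
  moreover have "\<chi>0 c = 1" using c by (simp add: \<chi>0_def)
  hence "(\<Sum>d=1..N. \<chi>0 d * mangoldt d / d) + (\<Sum>\<chi>\<in>X-{\<chi>0}. \<chi> c * (\<Sum>d=1..N. \<chi> d * mangoldt d / d)) = 0"
    using vanish[of N] sum.remove[OF fin \<chi>0, of "\<lambda>\<chi>. \<chi> c * (\<Sum>d=1..N. \<chi> d * mangoldt d / d)"] by simp
  moreover have "\<bar>\<Sum>\<chi>\<in>X-{\<chi>0}. \<chi> c * (\<Sum>d=1..N. \<chi> d * mangoldt d / d)\<bar> \<le> (\<Sum>\<chi>\<in>X-{\<chi>0}. B \<chi>)"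
    using B by (intro order.trans[OF sum_abs] sum_mono) blast
  ultimately show False by linarith
qed

subsection \<open>Quaternary lattices of determinant 2\<close>

lemma nearest_multiple:
  fixes x g :: int
  assumes "g > 0"
  shows "\<exists>k. 4 * (x - k * g)\<^sup>2 \<le> g\<^sup>2"
proof -
  define k where "k = (2 * x + g) div (2 * g)"
  have "2 * x + g = 2 * g * k + (2 * x + g) mod (2 * g)" by (simp add: k_def)
  moreover have "0 \<le> (2 * x + g) mod (2 * g)" "(2 * x + g) mod (2 * g) < 2 * g" using assms by auto
  ultimately have "\<bar>2 * (x - k * g)\<bar> \<le> g" by (simp add: algebra_simps abs_le_iff)
  hence "\<bar>2 * (x - k * g)\<bar>\<^sup>2 \<le> g\<^sup>2" by (intro power_mono) auto
  moreover have "\<bar>2 * (x - k * g)\<bar>\<^sup>2 = 4 * (x - k * g)\<^sup>2"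
    by (simp only: power2_abs power_mult_distrib) simp
  ultimately show ?thesis by auto
qed

text \<open>\<open>Q\<close> is a leading Gram minor, \<open>Q'\<close> its replacement after a
  swap, \<open>P\<close> the product of the neighbouring minors and \<open>l\<close> a size-reduced
  off-diagonal minor; Q Q' is less than (3/4 + 1/4) Q^2.\<close>

lemma minor_decrease:
  fixes P Q Q' l :: int
  assumes "P > 0" "Q > 0" "4 * P < 3 * Q\<^sup>2" "4 * l\<^sup>2 \<le> Q\<^sup>2" "Q * Q' = P + l\<^sup>2"
  shows "Q' > 0" "Q' < Q"
proof -
  have "Q * Q' > 0" using assms by (simp add: add_pos_nonneg)
  thus "Q' > 0" using assms(2) by (simp add: zero_less_mult_iff)
  have "Q * Q' < Q * Q" using assms(3-5) by (simp add: power2_eq_square)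
  thus "Q' < Q" using assms(2) by simp
qed

text \<open>Here 2 is the full determinant. Squaring the middle inequality and inserting the other
  two gives 81 q^2 \<le> 512, hence \<open>q \<le> 2\<close>; the few remaining cases are
  checked.\<close>

lemma unit_minors:
  fixes p q r :: int
  assumes pos: "p > 0" "q > 0" "r > 0"
    and "3 * p\<^sup>2 \<le> 4 * q" "3 * q\<^sup>2 \<le> 4 * (p * r)" "3 * r\<^sup>2 \<le> 4 * (q * 2)"
  shows "p = 1 \<and> q = 1 \<and> r = 1"
proof -
  have "(3 * q\<^sup>2)\<^sup>2 \<le> (4 * (p * r))\<^sup>2" using assms by (intro power_mono) auto
  hence "9 * (9 * q^4) \<le> 16 * ((3 * p\<^sup>2) * (3 * r\<^sup>2))" by (simp add: power_mult_distrib power_even_eq)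
  also have "(3 * p\<^sup>2) * (3 * r\<^sup>2) \<le> (4 * q) * (4 * (q * 2))" by (rule mult_mono) (use assms in auto)
  finally have "81 * q\<^sup>2 * q\<^sup>2 \<le> 512 * q\<^sup>2" by (simp add: power2_eq_square power4_eq_xxxx)
  hence "81 * q\<^sup>2 \<le> 512" using pos by simp
  hence "q < 3" using power_mono[of 3 q 2] by (cases "q < 3") auto
  moreover have "p < 2" if "q \<le> 2" using assms(4) that power_mono[of 2 p 2] by (cases "p < 2") auto
  ultimately have p: "p = 1" using pos by auto
  have "r < 3" if "q \<le> 2" using assms(6) that power_mono[of 3 r 2] by (cases "r < 3") auto
  with \<open>q < 3\<close> pos have "r = 1 \<or> r = 2" "q = 1 \<or> q = 2" by auto
  with assms(5,6) p show ?thesis by auto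
qed

text \<open>The module is abstract, so that changes of basis are equations between vectors;
  \<open>integral_representation\<close> instantiates it with integer quadruples.\<close>

locale integral_bilinear_form =
  fixes B :: "'v::ab_group_add \<Rightarrow> 'v \<Rightarrow> int" and scale :: "int \<Rightarrow> 'v \<Rightarrow> 'v"  (infixr "*s" 75)
  assumes add_left: "B (x + y) z = B x z + B y z"
    and scale_left: "B (k *s x) z = k * B x z"
    and commute: "B x y = B y x"
    and scale_scale: "j *s k *s x = (j * k) *s x"
    and scale_add: "k *s (x + y) = k *s x + k *s y"
    and add_scale: "(j + k) *s x = j *s x + k *s x"
    and scale_one: "1 *s x = x"
begin

lemma add_right: "B z (x + y) = B z x + B z y"
  using add_left commute by metis

lemma scale_right: "B z (k *s x) = k * B z x"
  using scale_left commute by metis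

lemma diff_left: "B (x - y) z = B x z - B y z"
  using add_left[of "x - y" y z] by simp

lemma diff_right: "B z (x - y) = B z x - B z y"
  using diff_left commute by metis

lemmas bilinear = add_left add_right scale_left scale_right diff_left diff_right

lemma scale_zero: "0 *s x = 0"
  using add_scale[of 0 0 x] by simp

definition span4 where
  "span4 a b c d = {\<alpha> *s a + \<beta> *s b + \<gamma> *s c + \<delta> *s d | \<alpha> \<beta> \<gamma> \<delta>. True}"

lemma span4_add: "v \<in> span4 a b c d \<Longrightarrow> w \<in> span4 a b c d \<Longrightarrow> v + w \<in> span4 a b c d"
proof -
  assume "v \<in> span4 a b c d" "w \<in> span4 a b c d"
  then obtain \<alpha> \<beta> \<gamma> \<delta> \<alpha>' \<beta>' \<gamma>' \<delta>' where
    "v = \<alpha> *s a + \<beta> *s b + \<gamma> *s c + \<delta> *s d" "w = \<alpha>' *s a + \<beta>' *s b + \<gamma>' *s c + \<delta>' *s d"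
    unfolding span4_def by blast
  hence "v + w = (\<alpha> + \<alpha>') *s a + (\<beta> + \<beta>') *s b + (\<gamma> + \<gamma>') *s c + (\<delta> + \<delta>') *s d"
    by (simp add: add_scale add_ac)
  thus ?thesis unfolding span4_def by blast
qed

lemma span4_scale: "v \<in> span4 a b c d \<Longrightarrow> k *s v \<in> span4 a b c d"
proof -
  assume "v \<in> span4 a b c d"
  then obtain \<alpha> \<beta> \<gamma> \<delta> where "v = \<alpha> *s a + \<beta> *s b + \<gamma> *s c + \<delta> *s d"
    unfolding span4_def by blast
  hence "k *s v = (k * \<alpha>) *s a + (k * \<beta>) *s b + (k * \<gamma>) *s c + (k * \<delta>) *s d"
    by (simp add: scale_add scale_scale)
  thus ?thesis unfolding span4_def by blast
qed

lemma span4_base: "a \<in> span4 a b c d" "b \<in> span4 a b c d" "c \<in> span4 a b c d" "d \<in> span4 a b c d"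
proof -
  have "a = 1 *s a + 0 *s b + 0 *s c + 0 *s d" "b = 0 *s a + 1 *s b + 0 *s c + 0 *s d"
    "c = 0 *s a + 0 *s b + 1 *s c + 0 *s d" "d = 0 *s a + 0 *s b + 0 *s c + 1 *s d"
    by (simp_all add: scale_zero scale_one)
  thus "a \<in> span4 a b c d" "b \<in> span4 a b c d" "c \<in> span4 a b c d" "d \<in> span4 a b c d"
    unfolding span4_def by blast+
qed

lemma span4_shear: "x - k *s y \<in> span4 a b c d \<Longrightarrow> y \<in> span4 a b c d \<Longrightarrow> x \<in> span4 a b c d"
  using span4_add[of "x - k *s y" a b c d "k *s y"] span4_scale by simp

lemma span4_subset:
  assumes "a \<in> span4 a' b' c' d'" "b \<in> span4 a' b' c' d'" "c \<in> span4 a' b' c' d'" "d \<in> span4 a' b' c' d'"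
  shows "span4 a b c d \<subseteq> span4 a' b' c' d'"
proof
  fix v assume "v \<in> span4 a b c d"
  then obtain \<alpha> \<beta> \<gamma> \<delta> where v: "v = \<alpha> *s a + \<beta> *s b + \<gamma> *s c + \<delta> *s d"
    unfolding span4_def by blast
  show "v \<in> span4 a' b' c' d'"
    unfolding v by (intro span4_add span4_scale assms)
qed

section \<open>Gram determinants and their behaviour under changes of basis\<close>

definition gram2 where "gram2 a b = B a a * B b b - (B a b)\<^sup>2"

definition gram3 where
  "gram3 a b c = B a a * B b b * B c c + 2 * B a b * B b c * B a c
     - B a a * (B b c)\<^sup>2 - B b b * (B a c)\<^sup>2 - B c c * (B a b)\<^sup>2"

text \<open>The minor of the Gram matrix with rows \<open>a\<close>, \<open>b\<close> and columns
  \<open>a\<close>, \<open>c\<close>; likewise \<open>minor3\<close> has rows \<open>a\<close>,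
  \<open>b\<close>, \<open>c\<close> and columns \<open>a\<close>, \<open>b\<close>,
  \<open>d\<close>.\<close>

definition minor2 where "minor2 a b c = B a a * B b c - B a b * B a c"

definition minor3 where
  "minor3 a b c d = (B a a * B b b - (B a b)\<^sup>2) * B c d + B a b * B b d * B a c + B a b * B b c * B a d
     - B a a * B b c * B b d - B b b * B a c * B a d"

definition gram4 where
  "gram4 a b c d = B d d * gram3 a b c
     - (B a d)\<^sup>2 * gram2 b c - (B b d)\<^sup>2 * gram2 a c - (B c d)\<^sup>2 * gram2 a b
     + 2 * B a d * B b d * (B a b * B c c - B a c * B b c)
     - 2 * B a d * B c d * (B a b * B b c - B a c * B b b)
     + 2 * B b d * B c d * (B a a * B b c - B a b * B a c)"

text \<open>Sylvester's determinant identity. With \<open>gram4_identity\<close> it supplies the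
  equation \<open>Q * Q' = P + l\<^sup>2\<close> of \<open>minor_decrease\<close>.\<close>

lemma gram3_identity: "gram2 a b * gram2 a c = B a a * gram3 a b c + (minor2 a b c)\<^sup>2"
  unfolding gram2_def gram3_def minor2_def by Groebner_Basis.algebra

lemma gram4_identity: "gram3 a b c * gram3 a b d = gram2 a b * gram4 a b c d + (minor3 a b c d)\<^sup>2"
  unfolding gram2_def gram3_def gram4_def minor3_def by Groebner_Basis.algebra

lemma gram2_shear: "gram2 a (b - k *s a) = gram2 a b"
  unfolding gram2_def bilinear commute[of b a] by Groebner_Basis.algebra

text \<open>A shear moves the off-diagonal minor by a multiple of the leading one, so
  \<open>nearest_multiple\<close> can size-reduce it.\<close>

lemma minor2_shear: "minor2 a b (c - k *s b) = minor2 a b c - k * gram2 a b"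
  unfolding gram2_def minor2_def bilinear by Groebner_Basis.algebra

lemma gram3_shear:
  "gram3 a (b - k *s a) c = gram3 a b c"
  "gram3 a b (c - k *s a) = gram3 a b c"
  "gram3 a b (c - k *s b) = gram3 a b c"
  unfolding gram3_def bilinear commute[of b a] commute[of c a] commute[of c b] by Groebner_Basis.algebra+

lemma minor3_shear: "minor3 a b c (d - k *s c) = minor3 a b c d - k * gram3 a b c"
  unfolding gram3_def minor3_def bilinear by Groebner_Basis.algebra

lemma gram4_shear:
  "gram4 a (b - k *s a) c d = gram4 a b c d"
  "gram4 a b (c - k *s a) d = gram4 a b c d"
  "gram4 a b (c - k *s b) d = gram4 a b c d"
  "gram4 a b c (d - k *s a) = gram4 a b c d"
  "gram4 a b c (d - k *s b) = gram4 a b c d"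
  "gram4 a b c (d - k *s c) = gram4 a b c d"
  unfolding gram4_def gram3_def gram2_def bilinear commute[of b a] commute[of c a] commute[of c b]
    commute[of d a] commute[of d b] commute[of d c]
  by Groebner_Basis.algebra+

lemma gram_swap:
  "gram2 b a = gram2 a b" "gram3 b a c = gram3 a b c" "gram3 a c b = gram3 a b c"
  "gram4 b a c d = gram4 a b c d" "gram4 a c b d = gram4 a b c d" "gram4 a b d c = gram4 a b c d"
  unfolding gram4_def gram3_def gram2_def commute[of b a] commute[of c a] commute[of c b]
    commute[of d a] commute[of d b] commute[of d c]
  by Groebner_Basis.algebra+

text \<open>
  Size reduction followed by a swap of neighbours changes a single leading minor, and decreases it unless the
  Lovasz condition with parameter 1 holds; at determinant 2 that condition forces all smaller minors to be 1.
\<close>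

lemma exists_unit_minors:
  assumes "B a a > 0" "gram2 a b > 0" "gram3 a b c > 0" "gram4 a b c d = 2"
  shows "\<exists>a' b' c' d'. B a' a' = 1 \<and> gram2 a' b' = 1 \<and> gram3 a' b' c' = 1 \<and> gram4 a' b' c' d' = 2 \<and>
    span4 a b c d \<subseteq> span4 a' b' c' d'"
  using assms
proof (induction "nat (B a a * gram2 a b * gram3 a b c)" arbitrary: a b c d rule: less_induct)
  case less
  note pos = less.prems(1-3) and det = less.prems(4)
  have decrease: ?case
    if "B a' a' > 0" "gram2 a' b' > 0" "gram3 a' b' c' > 0" "gram4 a' b' c' d' = 2"
      "B a' a' * gram2 a' b' * gram3 a' b' c' < B a a * gram2 a b * gram3 a b c"
      "span4 a b c d \<subseteq> span4 a' b' c' d'" for a' b' c' d'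
  proof -
    have "nat (B a' a' * gram2 a' b' * gram3 a' b' c') < nat (B a a * gram2 a b * gram3 a b c)"
      using that(5) pos by (simp add: nat_less_eq_zless that(1-3))
    from less.hyps[OF this that(1-4)] that(6) show ?thesis by blast
  qed
  \<comment> \<open>Each of the first three cases violates the condition at one adjacent pair and
    lowers the minor squared on the right; in the fourth \<open>unit_minors\<close> applies.\<close>
  consider "4 * gram2 a b < 3 * (B a a)\<^sup>2" | "4 * (B a a * gram3 a b c) < 3 * (gram2 a b)\<^sup>2"
    | "4 * (gram2 a b * gram4 a b c d) < 3 * (gram3 a b c)\<^sup>2"
    | "4 * gram2 a b \<ge> 3 * (B a a)\<^sup>2" "4 * (B a a * gram3 a b c) \<ge> 3 * (gram2 a b)\<^sup>2"
      "4 * (gram2 a b * gram4 a b c d) \<ge> 3 * (gram3 a b c)\<^sup>2"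
    by linarith
  thus ?case
  proof cases
    case 1
    obtain k where k: "4 * (B a b - k * B a a)\<^sup>2 \<le> (B a a)\<^sup>2"
      using nearest_multiple pos(1) by blast
    define b' where "b' = b - k *s a"
    have "B a a * B b' b' = gram2 a b + (B a b - k * B a a)\<^sup>2"
      using gram2_shear[of a b k] by (simp add: gram2_def b'_def[symmetric]) (simp add: b'_def bilinear)
    hence "B b' b' > 0" "B b' b' < B a a"
      using minor_decrease[of "gram2 a b" "B a a"] pos 1 k by blast+
    moreover have "gram2 b' a = gram2 a b" "gram3 b' a c = gram3 a b c" "gram4 b' a c d = gram4 a b c d"
      using gram_swap(1)[of b' a] gram_swap(2)[of b' a c] gram_swap(4)[of b' a c d]
      by (simp_all add: b'_def gram2_shear gram3_shear gram4_shear)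
    ultimately show ?thesis
      by (intro decrease[of b' a c d] span4_subset)
        (use pos det in \<open>auto simp: span4_base b'_def intro: span4_shear[of b k a]\<close>)
  next
    case 2
    obtain k where k: "4 * (minor2 a b c - k * gram2 a b)\<^sup>2 \<le> (gram2 a b)\<^sup>2"
      using nearest_multiple pos(2) by blast
    define c' where "c' = c - k *s b"
    have "gram2 a b * gram2 a c' = B a a * gram3 a b c + (minor2 a b c - k * gram2 a b)\<^sup>2"
      using gram3_identity[of a b c'] by (simp add: c'_def gram3_shear minor2_shear)
    hence "gram2 a c' > 0" "gram2 a c' < gram2 a b"
      using minor_decrease[of "B a a * gram3 a b c" "gram2 a b"] pos 2 k by simp_all
    moreover have "gram3 a c' b = gram3 a b c" "gram4 a c' b d = gram4 a b c d"
      using gram_swap(3)[of a c' b] gram_swap(5)[of a c' b d]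
      by (simp_all add: c'_def gram3_shear gram4_shear)
    ultimately show ?thesis
      by (intro decrease[of a c' b d] span4_subset)
        (use pos det in \<open>auto simp: span4_base c'_def intro: span4_shear[of c k b]\<close>)
  next
    case 3
    obtain k where k: "4 * (minor3 a b c d - k * gram3 a b c)\<^sup>2 \<le> (gram3 a b c)\<^sup>2"
      using nearest_multiple pos(3) by blast
    define d' where "d' = d - k *s c"
    have "gram3 a b c * gram3 a b d' = gram2 a b * gram4 a b c d + (minor3 a b c d - k * gram3 a b c)\<^sup>2"
      using gram4_identity[of a b c d'] by (simp add: d'_def gram4_shear minor3_shear)
    hence "gram3 a b d' > 0" "gram3 a b d' < gram3 a b c"
      using minor_decrease[of "gram2 a b * gram4 a b c d" "gram3 a b c"] pos det 3 k by simp_all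
    moreover have "gram4 a b d' c = gram4 a b c d"
      using gram_swap(6)[of a b d' c] by (simp add: d'_def gram4_shear)
    ultimately show ?thesis
      by (intro decrease[of a b d' c] span4_subset)
        (use pos det in \<open>auto simp: span4_base d'_def intro: span4_shear[of d k c]\<close>)
  next
    case 4
    hence "B a a = 1 \<and> gram2 a b = 1 \<and> gram3 a b c = 1"
      using unit_minors[of "B a a" "gram2 a b" "gram3 a b c"] pos det by simp
    with det show ?thesis by blast
  qed
qed

text \<open>Once the first three minors are 1, Gram-Schmidt divides only by 1 and stays integral;
  the determinant gives the last vector norm 2.\<close>

lemma exists_orthogonal_basis:
  assumes "B a' a' > 0" "gram2 a' b' > 0" "gram3 a' b' c' > 0" "gram4 a' b' c' d' = 2"
  shows "\<exists>r s t u. B r r = 1 \<and> B s s = 1 \<and> B t t = 1 \<and> B u u = 2 \<and>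
    B r s = 0 \<and> B r t = 0 \<and> B s t = 0 \<and> B r u = 0 \<and> B s u = 0 \<and> B t u = 0 \<and>
    span4 a' b' c' d' \<subseteq> span4 r s t u"
proof -
  obtain r b c d where unit: "B r r = 1" "gram2 r b = 1" "gram3 r b c = 1" "gram4 r b c d = 2"
    and sub: "span4 a' b' c' d' \<subseteq> span4 r b c d"
    using exists_unit_minors[OF assms] by blast
  define s where "s = b - B r b *s r"
  define t\<^sub>1 where "t\<^sub>1 = c - B r c *s r"
  define t where "t = t\<^sub>1 - B s t\<^sub>1 *s s"
  define u\<^sub>1 where "u\<^sub>1 = d - B r d *s r"
  define u\<^sub>2 where "u\<^sub>2 = u\<^sub>1 - B s u\<^sub>1 *s s"
  define u where "u = u\<^sub>2 - B t u\<^sub>2 *s t"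
  have g: "gram2 r s = 1" "gram3 r s t = 1" "gram4 r s t u = 2"
    using unit by (simp_all add: s_def t_def t\<^sub>1_def u_def u\<^sub>2_def u\<^sub>1_def gram2_shear gram3_shear gram4_shear)
  have rs: "B r s = 0" unfolding s_def bilinear unit by simp
  have ss: "B s s = 1" using g(1) by (simp add: gram2_def unit rs)
  have "B r t\<^sub>1 = 0" unfolding t\<^sub>1_def bilinear unit by simp
  hence rt: "B r t = 0" unfolding t_def bilinear by (simp add: rs)
  have st: "B s t = 0" unfolding t_def bilinear ss by simp
  have tt: "B t t = 1" using g(2) by (simp add: gram3_def unit rs rt st ss)
  have "B r u\<^sub>1 = 0" unfolding u\<^sub>1_def bilinear unit by simp
  hence ru2: "B r u\<^sub>2 = 0" unfolding u\<^sub>2_def bilinear by (simp add: rs)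
  hence ru: "B r u = 0" unfolding u_def bilinear by (simp add: rt)
  have "B s u\<^sub>2 = 0" unfolding u\<^sub>2_def bilinear ss by simp
  hence su: "B s u = 0" unfolding u_def bilinear by (simp add: st)
  have tu: "B t u = 0" unfolding u_def bilinear tt by simp
  have uu: "B u u = 2"
    using g(3) by (simp add: gram4_def gram3_def gram2_def unit rs rt st ss tt ru su tu)
  have "span4 r b c d \<subseteq> span4 r s t u"
  proof (rule span4_subset)
    show "r \<in> span4 r s t u" by (rule span4_base)
    show "b \<in> span4 r s t u"
      by (rule span4_shear[of _ "B r b" r]) (simp_all add: span4_base flip: s_def)
    have "t\<^sub>1 \<in> span4 r s t u"
      by (rule span4_shear[of _ "B s t\<^sub>1" s]) (simp_all add: span4_base flip: t_def)
    thus "c \<in> span4 r s t u"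
      by (intro span4_shear[of c "B r c" r]) (simp_all add: span4_base flip: t\<^sub>1_def)
    have "u\<^sub>2 \<in> span4 r s t u"
      by (rule span4_shear[of _ "B t u\<^sub>2" t]) (simp_all add: span4_base flip: u_def)
    hence "u\<^sub>1 \<in> span4 r s t u"
      by (intro span4_shear[of u\<^sub>1 "B s u\<^sub>1" s]) (simp_all add: span4_base flip: u\<^sub>2_def)
    thus "d \<in> span4 r s t u"
      by (intro span4_shear[of d "B r d" r]) (simp_all add: span4_base flip: u\<^sub>1_def)
  qed
  with sub unit(1) ss tt uu rs rt st ru su tu show ?thesis by blast
qed

text \<open>Pairing \<open>e\<close> with the vectors of norm 1 shows that three of its coordinates
  are odd, so norm 5 forces all four to be 1 or -1. These signs are absorbed into the coordinates of
  \<open>v\<close>.\<close>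

lemma representation_by_characteristic_vector:
  assumes pos: "B a a > 0" "gram2 a b > 0" "gram3 a b c > 0" "gram4 a b c d = 2"
    and e: "e \<in> span4 a b c d" "B e e = 5" "\<And>x. even (B x x - B x e)"
    and v: "v \<in> span4 a b c d"
  shows "\<exists>w x y z. B v v = 2 * w\<^sup>2 + x\<^sup>2 + y\<^sup>2 + z\<^sup>2 \<and> B v e = 2 * w + x + y + z"
proof -
  obtain r s t u where norm: "B r r = 1" "B s s = 1" "B t t = 1" "B u u = 2"
    and orth: "B r s = 0" "B r t = 0" "B s t = 0" "B r u = 0" "B s u = 0" "B t u = 0"
    and sub: "span4 a b c d \<subseteq> span4 r s t u"
    using exists_orthogonal_basis[OF pos] by blast
  have orth': "B s r = 0" "B t r = 0" "B t s = 0" "B u r = 0" "B u s = 0" "B u t = 0"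
    using orth commute by metis+
  obtain i j k l where e_eq: "e = i *s r + j *s s + k *s t + l *s u"
    using sub e(1) unfolding span4_def by blast
  obtain x y z w where v_eq: "v = x *s r + y *s s + z *s t + w *s u"
    using sub v unfolding span4_def by blast
  have "odd i" "odd j" "odd k"
    using e(3)[of r] e(3)[of s] e(3)[of t] by (simp_all add: e_eq bilinear norm orth orth')
  have ee: "i\<^sup>2 + j\<^sup>2 + k\<^sup>2 + 2 * l\<^sup>2 = 5"
    using e(2) by (simp add: e_eq bilinear norm orth orth' power2_eq_square)
  have odd_sq: "m\<^sup>2 = 1 \<or> m\<^sup>2 \<ge> 9" if "odd m" for m :: int
  proof -
    have "\<bar>m\<bar> = 1 \<or> \<bar>m\<bar> \<ge> 3" using that by presburger
    thus ?thesis using power_mono[of 3 "\<bar>m\<bar>" 2] by (auto simp: power2_eq_1_iff abs_eq_iff)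
  qed
  have i: "i\<^sup>2 = 1" "j\<^sup>2 = 1" "k\<^sup>2 = 1" "l\<^sup>2 = 1"
    using odd_sq[OF \<open>odd i\<close>] odd_sq[OF \<open>odd j\<close>] odd_sq[OF \<open>odd k\<close>] ee
      zero_le_power2[of l] zero_le_power2[of i] zero_le_power2[of j] zero_le_power2[of k] by linarith+
  have "B v v = 2 * w\<^sup>2 + x\<^sup>2 + y\<^sup>2 + z\<^sup>2"
    by (simp add: v_eq bilinear norm orth orth' power2_eq_square)
  moreover have "B v e = 2 * (l * w) + i * x + j * y + k * z"
    by (simp add: v_eq e_eq bilinear norm orth orth')
  ultimately have "B v v = 2 * (l * w)\<^sup>2 + (i * x)\<^sup>2 + (j * y)\<^sup>2 + (k * z)\<^sup>2 \<and> B v e = 2 * (l * w) + i * x + j * y + k * z"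
    by (simp add: power_mult_distrib i)
  thus ?thesis by blast
qed

end

subsection \<open>The lattice attached to a pair of forms\<close>

lemma Legendre_cong: "[a = b] (mod p) \<Longrightarrow> Legendre a p = Legendre b p"
  by (simp add: Legendre_def QuadRes_def cong_def)

lemma Legendre_square: "Legendre a p \<noteq> 0 \<Longrightarrow> Legendre a p * Legendre a p = 1"
  by (simp add: Legendre_def split: if_splits)

lemma cong_small_imp_eq:
  fixes x y p :: int
  assumes "[x = y] (mod p)" "\<bar>x - y\<bar> < p"
  shows "x = y"
proof (rule ccontr)
  assume "x \<noteq> y"
  hence "\<bar>p\<bar> \<le> \<bar>x - y\<bar>" using assms(1) by (intro dvd_imp_le_int) (auto simp: cong_iff_dvd_diff)
  with assms(2) show False by simp
qed

lemma Legendre_mult: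
  assumes p: "prime p" "p > 2"
  shows "Legendre (a * b) (int p) = Legendre a p * Legendre b p"
proof (rule cong_small_imp_eq)
  have "[Legendre (a * b) p = (a * b) ^ ((p - 1) div 2)] (mod p)"
    by (rule euler_criterion[OF p])
  also have "[(a * b) ^ ((p - 1) div 2) = Legendre a p * Legendre b p] (mod p)"
    unfolding power_mult_distrib by (intro cong_mult cong_sym[OF euler_criterion[OF p]])
  finally show "[Legendre (a * b) p = Legendre a p * Legendre b p] (mod p)" .
  have "\<bar>Legendre a p * Legendre b p\<bar> \<le> 1" "\<bar>Legendre (a * b) p\<bar> \<le> 1"
    by (simp_all add: Legendre_def)
  thus "\<bar>Legendre (a * b) p - Legendre a p * Legendre b p\<bar> < int p" using p by linarith
qed

lemma Legendre_one:
  assumes "prime p"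
  shows "Legendre 1 (int p) = 1"
proof -
  have "\<not> [1 = 0] (mod int p)" using prime_gt_1_nat[OF assms] by (simp add: cong_def)
  moreover have "[1\<^sup>2 = 1] (mod int p)" by simp
  ultimately show ?thesis unfolding Legendre_def QuadRes_def by metis
qed

lemma Legendre_minus_one:
  assumes p: "prime p" "p > 2"
  shows "Legendre (-1) (int p) = (-1) ^ ((p - 1) div 2)"
proof (rule cong_small_imp_eq)
  show "[Legendre (-1) (int p) = (-1) ^ ((p - 1) div 2)] (mod p)"
    by (rule euler_criterion[OF p])
  have "\<bar>Legendre (-1) p\<bar> \<le> 1" by (simp add: Legendre_def)
  moreover have "\<bar>(-1 :: int) ^ ((p - 1) div 2)\<bar> = 1" by (simp add: power_abs)
  ultimately show "\<bar>Legendre (-1) p - (-1) ^ ((p - 1) div 2)\<bar> < int p" using p by linarith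
qed

lemma Legendre_mod_5_nonresidue:
  assumes "d mod 5 = 2 \<or> d mod 5 = (3::int)"
  shows "Legendre d 5 = -1"
proof -
  have "\<not> [y\<^sup>2 = d] (mod 5)" for y
  proof -
    have "y mod 5 \<in> {0, 1, 2, 3, 4}" by auto
    hence "y\<^sup>2 mod 5 \<in> {0, 1, 4}" by (subst power_mod[symmetric]) auto
    thus ?thesis using assms by (auto simp: cong_def)
  qed
  moreover have "\<not> [d = 0] (mod 5)" using assms by (auto simp: cong_def)
  ultimately show ?thesis by (simp add: Legendre_def QuadRes_def)
qed

text \<open>Sign bookkeeping for a prime \<open>q\<close>: \<open>a\<close>, \<open>b\<close>,
  \<open>c\<close>, \<open>d\<close> stand for the symbols (-1/q), (5/q), (A/q), (p/q), and
  \<open>x\<close>, \<open>y\<close> for (q/p), (q/5).\<close>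

lemma eq_of_sign_products:
  fixes a b c d x y :: int
  assumes "a * (b * (c * (c * d))) = 1" "d * x = a" "b * y = 1" "b * b = 1" "c * c = 1" "d * d = 1"
  shows "x = y"
proof -
  have "x = d * (d * x)" using assms(6) by (simp flip: mult.assoc)
  also have "\<dots> = (c * c) * (b * b) * (a * d)" using assms by simp
  also have "\<dots> = b * (a * (b * (c * (c * d))))" by (simp only: mult_ac)
  also have "\<dots> = b * (b * y)" using assms by simp
  also have "\<dots> = y" using assms(4) by (simp only: mult.assoc[symmetric] mult_1)
  finally show ?thesis .
qed

text \<open>For a prime \<open>q\<close> dividing \<open>d\<close>, -5 A^2 p is 1 modulo
  \<open>q\<close>, so (-5p/q) = 1. Reciprocity gives (p/q)(q/p) = (-1/q), as \<open>p\<close> is 3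
  modulo 4, and (5/q) = (q/5); hence (q/p) = (q/5). Multiplicativity extends this to
  \<open>d\<close>.\<close>

lemma Legendre_divisor_eq_Legendre_5:
  fixes p A d e :: nat
  assumes p: "prime p" "p mod 4 = 3" and e: "5 * A\<^sup>2 * p + 1 = e" and d: "d dvd e" "odd d"
  shows "Legendre d p = Legendre d 5"
  using d
proof (induction d rule: less_induct)
  case (less d)
  have p2: "p > 2" using p by (cases "p = 2") (auto simp: prime_ge_2_nat le_neq_implies_less)
  have five: "prime (5 :: nat)" by simp
  show ?case
  proof (cases "d = 1")
    case True
    thus ?thesis using Legendre_one[OF p(1)] Legendre_one[OF five] by simp
  next
    case False
    then obtain q where q: "prime q" "q dvd d" using prime_factor_nat by blast
    then obtain d' where d': "d = q * d'" by blast
    have "odd q" using q(2) less.prems(2) by auto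
    hence q2: "q > 2" using q(1) by (cases "q = 2") (auto simp: prime_ge_2_nat le_neq_implies_less)
    have qe: "q dvd 5 * A\<^sup>2 * p + 1" using q(2) less.prems(1) e by (auto intro: dvd_trans)
    have ndvd: "\<not> q dvd k" if "k dvd 5 * A\<^sup>2 * p" for k
    proof
      assume "q dvd k"
      hence "q dvd 5 * A\<^sup>2 * p" using that by (rule dvd_trans)
      hence "q dvd 1" using qe by (simp add: dvd_add_right_iff del: One_nat_def)
      thus False using q(1) by (simp add: not_prime_unit)
    qed
    have "q \<noteq> p" "q \<noteq> 5" using ndvd[of p] ndvd[of 5] by (auto simp: dvd_mult2)
    let ?L = "\<lambda>a. Legendre a (int q)"
    have "[(-1) * (5 * (int A * (int A * int p))) = 1] (mod int q)"
    proof -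
      have "int q dvd int (5 * A\<^sup>2 * p + 1)" using qe by (simp only: of_nat_dvd_iff)
      hence "int q dvd 1 - (-1) * (5 * (int A * (int A * int p)))"
        by (simp add: power2_eq_square mult_ac add.commute)
      thus ?thesis using cong_iff_dvd_diff cong_sym by blast
    qed
    hence "?L ((-1) * (5 * (int A * (int A * int p)))) = 1"
      using Legendre_cong Legendre_one[OF q(1)] by metis
    hence prod: "?L (-1) * (?L 5 * (?L A * (?L A * ?L p))) = 1"
      by (simp only: Legendre_mult[OF q(1) q2])
    have recip: "?L p * Legendre q p = ?L (-1)"
    proof -
      have "odd ((p - 1) div 2)" using p(2) by presburger
      hence "(-1 :: int) ^ ((p - 1) div 2 * ((q - 1) div 2)) = (-1) ^ ((q - 1) div 2)"
        by (simp add: power_mult)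
      thus ?thesis
        using Quadratic_Reciprocity[OF p(1) p2 q(1) q2] \<open>q \<noteq> p\<close> Legendre_minus_one[OF q(1) q2] by simp
    qed
    have recip5: "?L 5 * Legendre q 5 = 1"
    proof -
      have "(-1 :: int) ^ ((5 - 1) div 2 * ((q - 1) div 2)) = 1" by (simp add: power_mult)
      thus ?thesis using Quadratic_Reciprocity[OF five _ q(1) q2] \<open>q \<noteq> 5\<close> by simp
    qed
    have "Legendre q p = Legendre q 5"
    proof -
      have "?L 5 \<noteq> 0" "?L (int A) \<noteq> 0" "?L (int p) \<noteq> 0" using prod by auto
      hence "?L 5 * ?L 5 = 1" "?L (int A) * ?L (int A) = 1" "?L (int p) * ?L (int p) = 1"
        by (blast intro: Legendre_square)+
      with prod recip recip5 show ?thesis by (rule eq_of_sign_products)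
    qed
    moreover have "Legendre d' p = Legendre d' 5"
    proof (rule less.IH)
      show "d' dvd e" "odd d'" using less.prems d' by (auto intro: dvd_trans)
      thus "d' < d" using d' q(1) prime_gt_1_nat[of q] by (cases "d' = 0") auto
    qed
    ultimately show ?thesis
      using Legendre_mult[OF p(1) p2, of q d'] Legendre_mult[OF five, of q d'] d' by simp
  qed
qed

text \<open>Take a prime \<open>p\<close>, 3 modulo 4, with 5 A^2 p + 1 = 4m\<delta> and \<delta>
  odd. Then 4m\<delta> is 1 modulo 5, which makes \<delta> a nonresidue modulo 5, so (-\<delta>/p) =
  -(\<delta>/p) = -(\<delta>/5) = 1. A root \<open>D\<close> of -\<delta> modulo \<open>p\<close>
  gives \<open>K\<close> with Kp - D^2 = \<delta>.\<close>

lemma exists_auxiliary_coefficients: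
  fixes m :: nat
  assumes m: "m mod 5 = 2 \<or> m mod 5 = 3"
  shows "\<exists>p A K D :: int. p > 0 \<and> 4 * int m * (K * p - D\<^sup>2) - 5 * A\<^sup>2 * p = 1"
proof -
  have m0: "m > 0" using m by (cases m) auto
  have "\<not> 5 dvd 8 * m" using m by presburger
  hence "coprime 5 (8 * m)" by (intro prime_imp_coprime) auto
  from cong_solve_coprime_nat[OF this] obtain i where i: "[5 * i = 1] (mod (8 * m))" by auto
  \<comment> \<open>Solves 5c = 4m - 1 modulo 8m. The modulus 8m rather than 4m makes the cofactor
    \<delta> odd.\<close>
  define c where "c = (4 * m - 1) * i"
  have c: "[5 * c = 4 * m - 1] (mod (8 * m))"
    using cong_mult[OF i cong_refl[of "4 * m - 1"]] by (simp add: c_def mult_ac)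
  have "coprime (4 * m - 1) (4 * m)" using m0 by (intro coprime_diff_one_left_nat) auto
  moreover from this have "coprime (4 * m - 1) 2" by (rule coprime_divisors[OF dvd_refl, rotated]) simp
  ultimately have "coprime (4 * m - 1) (2 * (4 * m))" by (simp only: coprime_mult_right_iff)
  hence "coprime (4 * m - 1) (8 * m)" by (simp only: mult.assoc[symmetric]) simp
  hence "coprime (5 * c) (8 * m)" by (rule cong_imp_coprime[OF cong_sym[OF c]])
  hence cop: "coprime c (8 * m)" using coprime_mult_left_iff[of 5 c "8 * m"] by blast
  have c4: "c mod 4 = 3"
  proof -
    have "[5 * c = 4 * m - 1] (mod 4)" by (rule cong_dvd_modulus_nat[OF c]) simp
    hence "5 * c mod 4 = (4 * m - 1) mod 4" by (simp only: cong_def)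
    also have "4 * m - 1 = 3 + 4 * (m - 1)" using m0 by simp
    also have "\<dots> mod 4 = 3" by (simp only: mod_mult_self2) simp
    finally show ?thesis by presburger
  qed
  have nsq: "\<nexists>s. [s\<^sup>2 = c] (mod (8 * m))"
  proof
    assume "\<exists>s. [s\<^sup>2 = c] (mod (8 * m))"
    then obtain s where s: "[s\<^sup>2 = c] (mod (8 * m))" ..
    have "[s\<^sup>2 = c] (mod 4)" by (rule cong_dvd_modulus_nat[OF s]) simp
    hence "s\<^sup>2 mod 4 = 3" using c4 by (simp add: cong_def)
    moreover have "s mod 4 \<in> {0, 1, 2, 3}" by auto
    hence "s\<^sup>2 mod 4 \<in> {0, 1}" by (subst power_mod[symmetric]) auto
    ultimately show False by simp
  qed
  have "8 * m > 0" using m0 by simp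
  from exists_prime_times_square_cong[OF this cop nsq]
  obtain p A where p: "prime p" and pA: "[p * A\<^sup>2 = c] (mod (8 * m))" by blast
  have "[5 * A\<^sup>2 * p + 1 = 5 * c + 1] (mod (8 * m))"
    using cong_add[OF cong_mult[OF cong_refl[of 5] pA] cong_refl[of 1]] by (simp add: mult_ac)
  also have "[5 * c + 1 = 4 * m - 1 + 1] (mod (8 * m))" by (intro cong_add c cong_refl)
  finally have "(5 * A\<^sup>2 * p + 1) mod (8 * m) = 4 * m" using m0 by (simp add: cong_def)
  then obtain t where t: "5 * A\<^sup>2 * p + 1 = 4 * m * (2 * t + 1)"
    using div_mult_mod_eq[of "5 * A\<^sup>2 * p + 1" "8 * m"]
    by (intro that[of "(5 * A\<^sup>2 * p + 1) div (8 * m)"]) (simp add: algebra_simps)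
  define \<delta> where "\<delta> = 2 * t + 1"
  have p4: "p mod 4 = 3"
  proof -
    have "(5 * A\<^sup>2 * p + 1) mod 4 = 0" unfolding t by (simp add: mult.assoc)
    moreover have "X mod 4 = 3" if "(5 * X + 1) mod 4 = 0" for X :: nat using that by presburger
    ultimately have "(A\<^sup>2 * p) mod 4 = 3" by (simp only: mult.assoc)
    hence "(A\<^sup>2 mod 4 * (p mod 4)) mod 4 = 3" by (simp only: mod_mult_eq)
    moreover have "A mod 4 \<in> {0, 1, 2, 3}" by auto
    hence "A\<^sup>2 mod 4 \<in> {0, 1}" by (subst power_mod[symmetric]) auto
    ultimately show ?thesis by auto
  qed
  have p2: "p > 2" using p4 prime_ge_2_nat[OF p] by (cases "p = 2") auto
  have "Legendre (-1) p = -1"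
  proof -
    have "odd ((p - 1) div 2)" using p4 by presburger
    thus ?thesis using Legendre_minus_one[OF p p2] by simp
  qed
  moreover have "Legendre \<delta> p = Legendre \<delta> 5"
  proof (rule Legendre_divisor_eq_Legendre_5[OF p p4 t])
    show "\<delta> dvd 4 * m * (2 * t + 1)" unfolding \<delta>_def by (rule dvd_triv_right)
    show "odd \<delta>" by (simp add: \<delta>_def)
  qed
  moreover have "Legendre (int \<delta>) 5 = -1"
  proof (rule Legendre_mod_5_nonresidue)
    have "(4 * m * \<delta>) mod 5 = 1"
      unfolding \<delta>_def t[symmetric] by (simp add: mult.assoc mod_Suc)
    hence "(4 * (m mod 5) * (\<delta> mod 5)) mod 5 = 1"
      by (metis mod_mult_left_eq mod_mult_right_eq)
    moreover have "\<delta> mod 5 \<in> {0, 1, 2, 3, 4}" by auto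
    ultimately have "\<delta> mod 5 = 2 \<or> \<delta> mod 5 = 3" using m by auto
    thus "int \<delta> mod 5 = 2 \<or> int \<delta> mod 5 = 3" by presburger
  qed
  ultimately have "Legendre (- int \<delta>) p = 1"
    using Legendre_mult[OF p p2, of "-1" "int \<delta>"] by simp
  hence "QuadRes (int p) (- int \<delta>)" by (auto simp: Legendre_def split: if_splits)
  then obtain D where "[D\<^sup>2 = - int \<delta>] (mod int p)" by (auto simp: QuadRes_def)
  then obtain K where K: "D\<^sup>2 + int \<delta> = int p * K" by (auto simp: cong_iff_dvd_diff elim: dvdE)
  have "4 * int m * (K * int p - D\<^sup>2) - 5 * (int A)\<^sup>2 * int p = int (4 * m * \<delta>) - int (5 * A\<^sup>2 * p)"
    using K by (simp add: mult.commute)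
  also have "\<dots> = 1" unfolding \<delta>_def t[symmetric] by simp
  finally show ?thesis using p2 by (intro exI[of _ "int p"] exI) auto
qed

text \<open>The Gram matrix is tridiagonal with diagonal 5, \<open>S\<close>, \<open>2 * K\<close>,
  \<open>2 * p\<close> and off-diagonal \<open>T\<close>, \<open>A\<close>, \<open>2 * D\<close>.
  The first unit vector is characteristic because \<open>S - T\<close> and the last two diagonal
  entries are even. As 5 does not divide \<open>T\<close>, \<open>m\<close> is 2 or 3 modulo
  5.\<close>

lemma integral_representation:
  fixes S T :: int
  assumes pos: "T\<^sup>2 < 5 * S" and parity: "even (S - T)" and T: "\<not> 5 dvd T"
  shows "\<exists>w x y z. S = 2 * w\<^sup>2 + x\<^sup>2 + y\<^sup>2 + z\<^sup>2 \<and> T = 2 * w + x + y + z"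
proof -
  define m where "m = nat ((5 * S - T\<^sup>2) div 2)"
  have "even (5 * S - T\<^sup>2)" using parity by auto
  hence m: "5 * S - T\<^sup>2 = 2 * int m" using pos by (auto simp: m_def)
  have "T mod 5 \<in> {1, 2, 3, 4}" using T by (auto simp: dvd_eq_mod_eq_0)
  hence "T\<^sup>2 mod 5 = 1 \<or> T\<^sup>2 mod 5 = 4" by (subst (1 2) power_mod[symmetric]) auto
  hence "m mod 5 = 2 \<or> m mod 5 = 3" using m by presburger
  then obtain p A K D :: int where p: "p > 0" and eq: "4 * int m * (K * p - D\<^sup>2) - 5 * A\<^sup>2 * p = 1"
    using exists_auxiliary_coefficients by blast
  \<comment> \<open>\<open>e\<close> and \<open>v\<close> are the first two unit vectors; \<open>eq\<close> says that the Gram determinant is 2.\<close>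
  define B :: "int \<times> int \<times> int \<times> int \<Rightarrow> int \<times> int \<times> int \<times> int \<Rightarrow> int" where
    "B = (\<lambda>(x\<^sub>0, x\<^sub>1, x\<^sub>2, x\<^sub>3) (y\<^sub>0, y\<^sub>1, y\<^sub>2, y\<^sub>3). 5 * x\<^sub>0 * y\<^sub>0 + T * (x\<^sub>0 * y\<^sub>1 + x\<^sub>1 * y\<^sub>0) + S * x\<^sub>1 * y\<^sub>1
       + A * (x\<^sub>1 * y\<^sub>2 + x\<^sub>2 * y\<^sub>1) + 2 * K * x\<^sub>2 * y\<^sub>2 + 2 * D * (x\<^sub>2 * y\<^sub>3 + x\<^sub>3 * y\<^sub>2) + 2 * p * x\<^sub>3 * y\<^sub>3)"
  interpret integral_bilinear_form B "\<lambda>k (x\<^sub>0, x\<^sub>1, x\<^sub>2, x\<^sub>3). (k * x\<^sub>0, k * x\<^sub>1, k * x\<^sub>2, k * x\<^sub>3)"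
    by unfold_locales (auto simp: B_def algebra_simps split: prod.splits)
  let ?e = "(1, 0, 0, 0) :: int \<times> int \<times> int \<times> int" and ?v = "(0, 1, 0, 0) :: int \<times> int \<times> int \<times> int"
  let ?a = "(0, 0, 1, 0) :: int \<times> int \<times> int \<times> int" and ?b = "(0, 0, 0, 1) :: int \<times> int \<times> int \<times> int"
  have g2: "gram2 ?e ?v = 2 * int m" unfolding gram2_def using m by (simp add: B_def)
  have g3: "gram3 ?e ?v ?a = 4 * int m * K - 5 * A\<^sup>2"
  proof -
    have "gram3 ?e ?v ?a = 2 * K * (5 * S - T\<^sup>2) - 5 * A\<^sup>2"
      unfolding gram3_def by (simp add: B_def algebra_simps)
    thus ?thesis by (simp add: m)
  qed
  \<comment> \<open>Positivity of the third minor is read off from \<open>eq\<close> after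
    multiplication by \<open>p\<close>.\<close>
  have "p * gram3 ?e ?v ?a = 1 + 4 * int m * D\<^sup>2" unfolding g3 using eq by (simp add: algebra_simps)
  hence "p * gram3 ?e ?v ?a > 0" by (simp add: add_pos_nonneg)
  hence g3_pos: "gram3 ?e ?v ?a > 0" using p by (simp add: zero_less_mult_iff)
  have "gram4 ?e ?v ?a ?b = 2 * p * gram3 ?e ?v ?a - 4 * D\<^sup>2 * gram2 ?e ?v"
  proof -
    have "B ?e ?b = 0" "B ?v ?b = 0" "B ?a ?b = 2 * D" "B ?b ?b = 2 * p" by (simp_all add: B_def)
    thus ?thesis unfolding gram4_def by (simp add: power_mult_distrib)
  qed
  hence g4: "gram4 ?e ?v ?a ?b = 2" unfolding g2 g3 using eq by (simp add: algebra_simps)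
  have char: "even (B x x - B x ?e)" for x
    using parity by (cases x) (auto simp: B_def)
  have "\<exists>w x y z. B ?v ?v = 2 * w\<^sup>2 + x\<^sup>2 + y\<^sup>2 + z\<^sup>2 \<and> B ?v ?e = 2 * w + x + y + z"
  proof (rule representation_by_characteristic_vector[OF _ _ g3_pos g4 span4_base(1) _ char span4_base(2)])
    show "gram2 ?e ?v > 0" using g2 m pos by simp
  qed (simp_all add: B_def)
  thus ?thesis by (simp add: B_def)
qed

subsection \<open>Choice of the linear form's value\<close>

text \<open>Cauchy--Schwarz against the remaining coordinates keeps every coordinate nonnegative.\<close>

lemma natural_representation:
  fixes S T :: int
  assumes "T\<^sup>2 < 5 * S" "even (S - T)" "\<not> 5 dvd T" and T: "T \<ge> 0" "4 * S \<le> T\<^sup>2"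
  shows "\<exists>w x y z :: nat. S = 2 * (int w)\<^sup>2 + (int x)\<^sup>2 + (int y)\<^sup>2 + (int z)\<^sup>2 \<and>
    T = 2 * int w + int x + int y + int z"
proof -
  obtain w x y z where S: "S = 2 * w\<^sup>2 + x\<^sup>2 + y\<^sup>2 + z\<^sup>2" and T_eq: "T = 2 * w + x + y + z"
    using integral_representation[OF assms(1-3)] by blast
  \<comment> \<open>Here \<open>c\<close> is the weight of the coordinate \<open>t\<close>, so the
    others have total weight 5 - c \<le> 4. A negative \<open>t\<close> would make the left side
    exceed T^2 and the right side fall below it.\<close>
  have nonneg: "t \<ge> 0" if "(T - c * t)\<^sup>2 \<le> 4 * (S - c * t\<^sup>2)" "c > 0" for t c
  proof (rule ccontr)
    assume "\<not> t \<ge> 0"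
    hence "t < 0" by simp
    define u where "u = c * t"
    have "u < 0" using \<open>c > 0\<close> \<open>t < 0\<close> by (simp add: u_def mult_pos_neg)
    hence "T * u \<le> 0" "u\<^sup>2 > 0" using T(1) by (simp_all add: mult_nonneg_nonpos)
    moreover have "c * t\<^sup>2 > 0" using \<open>c > 0\<close> \<open>t < 0\<close> by simp
    moreover have "(T - u)\<^sup>2 = T\<^sup>2 - 2 * (T * u) + u\<^sup>2" by (simp add: power2_diff)
    moreover have "(T - u)\<^sup>2 \<le> 4 * S - 4 * (c * t\<^sup>2)" using that(1) by (simp add: u_def right_diff_distrib)
    ultimately show False using T(2) by linarith
  qed
  have "w \<ge> 0"
  proof (rule nonneg[of 2])
    have "4 * (S - 2 * w\<^sup>2) - (T - 2 * w)\<^sup>2 = (x - y)\<^sup>2 + (x - z)\<^sup>2 + (y - z)\<^sup>2 + (x\<^sup>2 + y\<^sup>2 + z\<^sup>2)"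
      unfolding S T_eq by Groebner_Basis.algebra
    also have "\<dots> \<ge> 0" by simp
    finally show "(T - 2 * w)\<^sup>2 \<le> 4 * (S - 2 * w\<^sup>2)" by simp
  qed simp
  moreover have "x \<ge> 0"
  proof (rule nonneg[of 1])
    have "4 * (S - 1 * x\<^sup>2) - (T - 1 * x)\<^sup>2 = 2 * (w - y)\<^sup>2 + 2 * (w - z)\<^sup>2 + (y - z)\<^sup>2"
      unfolding S T_eq by Groebner_Basis.algebra
    also have "\<dots> \<ge> 0" by simp
    finally show "(T - 1 * x)\<^sup>2 \<le> 4 * (S - 1 * x\<^sup>2)" by simp
  qed simp
  moreover have "y \<ge> 0"
  proof (rule nonneg[of 1])
    have "4 * (S - 1 * y\<^sup>2) - (T - 1 * y)\<^sup>2 = 2 * (w - x)\<^sup>2 + 2 * (w - z)\<^sup>2 + (x - z)\<^sup>2"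
      unfolding S T_eq by Groebner_Basis.algebra
    also have "\<dots> \<ge> 0" by simp
    finally show "(T - 1 * y)\<^sup>2 \<le> 4 * (S - 1 * y\<^sup>2)" by simp
  qed simp
  moreover have "z \<ge> 0"
  proof (rule nonneg[of 1])
    have "4 * (S - 1 * z\<^sup>2) - (T - 1 * z)\<^sup>2 = 2 * (w - x)\<^sup>2 + 2 * (w - y)\<^sup>2 + (x - y)\<^sup>2"
      unfolding S T_eq by Groebner_Basis.algebra
    also have "\<dots> \<ge> 0" by simp
    finally show "(T - 1 * z)\<^sup>2 \<le> 4 * (S - 1 * z\<^sup>2)" by simp
  qed simp
  ultimately show ?thesis using S T_eq
    by (intro exI[of _ "nat w"] exI[of _ "nat x"] exI[of _ "nat y"] exI[of _ "nat z"]) simp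
qed

text \<open>Since \<open>b > - a\<close>, all terms dropped are nonnegative. The first bound avoids
  the square root; the second keeps the part needed when \<open>b\<close> is large.\<close>

lemma large_bounds:
  fixes a b n :: int
  assumes a: "a > 0" and b: "b > - a"
    and n: "real_of_int n \<ge> 550 * real_of_int a * (60 * (real_of_int a)\<^sup>2 + real_of_int b)
           + 25 * (120 * (real_of_int a)\<^sup>2 + real_of_int b)
               * sqrt (2 * (60 * (real_of_int a)\<^sup>2 + real_of_int b))"
  shows "n \<ge> 550 * a * (60 * a\<^sup>2 + b)"
    and "b > 0 \<Longrightarrow> real_of_int n \<ge> 550 * real_of_int a * real_of_int b + 25 * real_of_int b * sqrt (2 * real_of_int b)"
proof -
  define s where "s = sqrt (2 * (60 * (real_of_int a)\<^sup>2 + real_of_int b))"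
  have "a \<le> a\<^sup>2" using a by (simp add: power2_eq_square)
  hence "60 * a\<^sup>2 + b \<ge> 0" "120 * a\<^sup>2 + b \<ge> 0" using a b by linarith+
  hence "real_of_int (60 * a\<^sup>2 + b) \<ge> 0" "real_of_int (120 * a\<^sup>2 + b) \<ge> 0"
    by (simp_all only: of_int_0_le_iff)
  hence nn: "60 * (real_of_int a)\<^sup>2 + real_of_int b \<ge> 0" "120 * (real_of_int a)\<^sup>2 + real_of_int b \<ge> 0"
    by simp_all
  have s0: "s \<ge> 0" using nn by (simp add: s_def)
  have "25 * (120 * (real_of_int a)\<^sup>2 + real_of_int b) * s \<ge> 0" using nn s0 by simp
  with n have "real_of_int n \<ge> 550 * real_of_int a * (60 * (real_of_int a)\<^sup>2 + real_of_int b)"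
    unfolding s_def by linarith
  hence "real_of_int n \<ge> real_of_int (550 * a * (60 * a\<^sup>2 + b))" by simp
  thus "n \<ge> 550 * a * (60 * a\<^sup>2 + b)" by (simp only: of_int_le_iff)
  assume "b > 0"
  have "sqrt (2 * real_of_int b) \<le> s" unfolding s_def by (rule real_sqrt_le_mono) simp
  hence "25 * real_of_int b * sqrt (2 * real_of_int b) \<le> 25 * (120 * (real_of_int a)\<^sup>2 + real_of_int b) * s"
    using \<open>b > 0\<close> s0 by (intro mult_mono) auto
  moreover have "550 * real_of_int a * real_of_int b \<le> 550 * real_of_int a * (60 * (real_of_int a)\<^sup>2 + real_of_int b)"
    using a by simp
  ultimately show "real_of_int n \<ge> 550 * real_of_int a * real_of_int b + 25 * real_of_int b * sqrt (2 * real_of_int b)"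
    using n unfolding s_def by linarith
qed

text \<open>For n = aS + bT the conclusions mean 4S \<le> T^2 and T^2 < 5S. The interval starts at
  the least \<open>T\<close> satisfying the first; its predecessor \<open>X\<close> violates it,
  which leaves room for the second.\<close>

lemma exists_long_interval:
  fixes a b n :: int
  assumes a: "a > 0" and b: "b > - a"
    and n: "real_of_int n \<ge> 550 * real_of_int a * (60 * (real_of_int a)\<^sup>2 + real_of_int b)
           + 25 * (120 * (real_of_int a)\<^sup>2 + real_of_int b)
               * sqrt (2 * (60 * (real_of_int a)\<^sup>2 + real_of_int b))"
  shows "\<exists>L\<ge>0. \<forall>T. L \<le> T \<and> T < L + 4 * a \<longrightarrow> 4 * n \<le> a * T\<^sup>2 + 4 * b * T \<and> a * T\<^sup>2 + 5 * b * T < 5 * n"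
proof -
  note bounds = large_bounds[OF assms]
  have a2: "a \<le> a\<^sup>2" using a by (simp add: power2_eq_square)
  have cube: "n \<ge> 32450 * (a * a\<^sup>2)"
  proof -
    have "550 * a * (59 * a\<^sup>2) \<le> 550 * a * (60 * a\<^sup>2 + b)" using a a2 b by (intro mult_left_mono) auto
    with bounds(1) show ?thesis by (simp add: mult_ac)
  qed
  moreover have "a * a\<^sup>2 > 0" using a by simp
  ultimately have n0: "n > 0" by linarith
  define P where "P T \<longleftrightarrow> 4 * n \<le> a * (int T)\<^sup>2 + 4 * b * int T" for T
  have "\<exists>T. P T"
  proof
    define T where "T = 4 * n + 4 * \<bar>b\<bar> + 1"
    have T: "T > 0" "T \<ge> 4 * n" using n0 by (auto simp: T_def)
    have "a * T \<ge> 1 * T" using a T by (intro mult_right_mono) auto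
    hence "a * T + 4 * b \<ge> 1" using n0 T_def abs_ge_minus_self[of b] by linarith
    hence "T * 1 \<le> T * (a * T + 4 * b)" using T by (intro mult_left_mono) auto
    hence "4 * n \<le> a * T\<^sup>2 + 4 * b * T" using T(2) by (simp add: algebra_simps power2_eq_square)
    thus "P (nat T)" using T by (simp add: P_def)
  qed
  define L where "L = (LEAST T. P T)"
  have PL: "P L" unfolding L_def using \<open>\<exists>T. P T\<close> by (rule LeastI_ex)
  have "L > 0" using PL n0 by (cases L) (auto simp: P_def)
  define X where "X = int L - 1"
  have "\<not> P (L - 1)" unfolding L_def by (rule not_less_Least) (use \<open>L > 0\<close> L_def in auto)
  hence X: "a * X\<^sup>2 + 4 * b * X < 4 * n" "X \<ge> 0"
    using \<open>L > 0\<close> by (auto simp: P_def X_def of_nat_diff)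
  have L: "4 * n \<le> a * (X + 1)\<^sup>2 + 4 * b * (X + 1)" using PL by (simp add: P_def X_def)
  \<comment> \<open>Otherwise 4n is at most 10000 a^3 + 400 ab, without the last term if b < 0,
    against n \<ge> 33000 a^3 + 550 ab or n \<ge> 32450 a^3.\<close>
  have X100: "X \<ge> 100 * a"
  proof (rule ccontr)
    assume "\<not> ?thesis"
    hence le: "X + 1 \<le> 100 * a" by simp
    have "(X + 1)\<^sup>2 \<le> (100 * a)\<^sup>2" using le X(2) by (intro power_mono) auto
    hence "a * (X + 1)\<^sup>2 \<le> a * (100 * a)\<^sup>2" using a by (intro mult_left_mono) auto
    hence 1: "a * (X + 1)\<^sup>2 \<le> 10000 * (a * a\<^sup>2)" by (simp add: power_mult_distrib mult_ac)
    have cube0: "a * a\<^sup>2 > 0" using a by simp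
    show False
    proof (cases "b \<ge> 0")
      case True
      have "b * (X + 1) \<le> b * (100 * a)" using True le by (intro mult_left_mono) auto
      moreover have "0 \<le> a * b" using True a by simp
      moreover have "n \<ge> 33000 * (a * a\<^sup>2) + 550 * (a * b)" using bounds(1) by (simp add: algebra_simps)
      ultimately show False using 1 L cube0 by (simp add: mult_ac)
    next
      case False
      hence "b * (X + 1) \<le> 0" using X(2) by (simp add: mult_nonpos_nonneg)
      with 1 L cube0 cube show False by linarith
    qed
  qed
  \<comment> \<open>Otherwise X < 10 sqrt(2b), so 4n \<le> 601 ab + 40 b sqrt(2b) + 4b, against the
    bound with the square root.\<close>
  have X200: "X\<^sup>2 \<ge> 200 * b"
  proof (rule ccontr)
    assume "\<not> ?thesis"
    hence lt: "X\<^sup>2 < 200 * b" by simp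
    hence b0: "b > 0" using zero_le_power2[of X] by linarith
    define s where "s = sqrt (2 * real_of_int b)"
    have s: "s \<ge> 0" "s\<^sup>2 = 2 * real_of_int b" using b0 by (auto simp: s_def)
    have "real_of_int (X\<^sup>2) < real_of_int (200 * b)" using lt by (simp only: of_int_less_iff)
    hence "(real_of_int X)\<^sup>2 < (10 * s)\<^sup>2" by (simp add: power_mult_distrib s)
    hence Xs: "real_of_int X < 10 * s" by (rule power2_less_imp_less) (use s(1) in simp)
    have "X * 1 \<le> X * X" using X100 a by (intro mult_left_mono) auto
    hence "X \<le> X\<^sup>2" by (simp add: power2_eq_square)
    moreover have "(X + 1)\<^sup>2 = X\<^sup>2 + 2 * X + 1" by Groebner_Basis.algebra
    ultimately have "(X + 1)\<^sup>2 \<le> 601 * b" using lt b0 by linarith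
    hence "a * (X + 1)\<^sup>2 \<le> a * (601 * b)" using a by (intro mult_left_mono) auto
    moreover have "a * (601 * b) = 601 * (a * b)" "4 * b * (X + 1) = 4 * (b * X) + 4 * b" by Groebner_Basis.algebra+
    ultimately have "4 * n \<le> 601 * (a * b) + 4 * (b * X) + 4 * b" using L by linarith
    hence "real_of_int (4 * n) \<le> real_of_int (601 * (a * b) + 4 * (b * X) + 4 * b)" by (simp only: of_int_le_iff)
    hence "4 * real_of_int n \<le> 601 * (real_of_int a * real_of_int b) + 4 * (real_of_int b * real_of_int X) + 4 * real_of_int b"
      by (simp only: of_int_add of_int_mult of_int_numeral)
    moreover have "real_of_int b * real_of_int X \<le> real_of_int b * (10 * s)"
      using Xs b0 by (intro mult_left_mono) auto
    hence "real_of_int b * real_of_int X \<le> 10 * (real_of_int b * s)" by (simp only: mult_ac)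
    moreover have "real_of_int n \<ge> 550 * (real_of_int a * real_of_int b) + 25 * (real_of_int b * s)"
      using bounds(2)[OF b0] by (simp only: s_def mult.assoc)
    moreover have "1 * real_of_int b \<le> real_of_int a * real_of_int b"
      using a b0 by (intro mult_right_mono) auto
    moreover have "0 \<le> real_of_int b * s" "real_of_int b > 0" using b0 s by auto
    ultimately show False by linarith
  qed
  \<comment> \<open>Moving from \<open>X\<close> to X + r costs at most (6/50 + 5/50) a X^2, less
    than the a X^2 / 4 gained by multiplying a X^2 + 4bX < 4n by 5/4.\<close>
  have upper: "a * (X + r)\<^sup>2 + 5 * b * (X + r) < 5 * n" if r: "0 \<le> r" "r \<le> 4 * a" for r
  proof -
    have rX: "25 * r \<le> X" using r X100 by linarith
    have "25 * r * X \<le> X * X" using rX X(2) by (intro mult_right_mono) auto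
    hence "25 * (X * r) \<le> X * X" by (simp only: mult_ac)
    moreover have "(25 * r) * (25 * r) \<le> X * X" using rX r by (intro mult_mono) auto
    hence "625 * (r * r) \<le> X * X" by simp
    moreover have "50 * (2 * X * r + r\<^sup>2) = 100 * (X * r) + 50 * (r * r)" "6 * X\<^sup>2 = 6 * (X * X)"
      by Groebner_Basis.algebra+
    ultimately have "50 * (2 * X * r + r\<^sup>2) \<le> 6 * X\<^sup>2"
      using zero_le_square[of X] by linarith
    hence 1: "a * (50 * (2 * X * r + r\<^sup>2)) \<le> a * (6 * X\<^sup>2)" using a by (intro mult_left_mono) auto
    have 2: "50 * (b * r) \<le> a * X\<^sup>2"
    proof (cases "b \<ge> 0")
      case True
      have "b * r \<le> b * (4 * a)" using True r by (intro mult_left_mono) auto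
      moreover have "a * (200 * b) \<le> a * X\<^sup>2" using a X200 by (intro mult_left_mono) auto
      moreover have "0 \<le> a * b" using a True by simp
      ultimately show ?thesis by (simp add: mult_ac)
    next
      case False
      hence "b * r \<le> 0" using r by (simp add: mult_nonpos_nonneg)
      moreover have "0 \<le> a * X\<^sup>2" using a by simp
      ultimately show ?thesis by linarith
    qed
    have "a * (X + r)\<^sup>2 + 5 * b * (X + r) = a * X\<^sup>2 + a * (2 * X * r + r\<^sup>2) + 5 * (b * X) + 5 * (b * r)"
      by Groebner_Basis.algebra
    moreover have "a * X\<^sup>2 + 4 * (b * X) < 4 * n" using X(1) by (simp add: mult.assoc)
    moreover have "0 \<le> a * X\<^sup>2" using a by simp
    ultimately show ?thesis using 1 2 by linarith
  qed
  have lower: "4 * n \<le> a * T\<^sup>2 + 4 * b * T" if "T \<ge> X + 1" for T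
  proof -
    have "a * (T + (X + 1)) + 4 * b \<ge> 0"
    proof -
      have "a * 4 \<le> a * (T + (X + 1))" using that X100 a by (intro mult_left_mono) auto
      thus ?thesis using b by linarith
    qed
    hence "0 \<le> (T - (X + 1)) * (a * (T + (X + 1)) + 4 * b)" using that by simp
    also have "\<dots> = (a * T\<^sup>2 + 4 * b * T) - (a * (X + 1)\<^sup>2 + 4 * b * (X + 1))" by Groebner_Basis.algebra
    finally show ?thesis using L by linarith
  qed
  show ?thesis
  proof (intro exI[of _ "X + 1"] conjI allI impI)
    fix T assume T: "X + 1 \<le> T \<and> T < X + 1 + 4 * a"
    show "4 * n \<le> a * T\<^sup>2 + 4 * b * T" using lower T by blast
    show "a * T\<^sup>2 + 5 * b * T < 5 * n" using upper[of "T - X"] T by simp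
  qed (use X in auto)
qed

theorem theorem4:
  fixes a b n :: int
  assumes "a > 0"
    and "b > - a"
    and "gcd a (5 * b) = 1"
    and "real_of_int n \<ge> 550 * real_of_int a * (60 * (real_of_int a)\<^sup>2 + real_of_int b)
           + 25 * (120 * (real_of_int a)\<^sup>2 + real_of_int b)
               * sqrt (2 * (60 * (real_of_int a)\<^sup>2 + real_of_int b))"
    and "odd (a * b) \<Longrightarrow> even n"
  shows "\<exists>w x y z :: nat.
           2 * int w * (a * int w + b) + int x * (a * int x + b)
             + int y * (a * int y + b) + int z * (a * int z + b) = n"
proof -
  have cop: "coprime a 5" "coprime a b"
    using assms(3) by (simp_all add: coprime_iff_gcd_eq_1[symmetric])
  obtain L where L0: "L \<ge> 0"
    and L: "\<And>T. L \<le> T \<Longrightarrow> T < L + 4 * a \<Longrightarrow> 4 * n \<le> a * T\<^sup>2 + 4 * b * T \<and> a * T\<^sup>2 + 5 * b * T < 5 * n"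
    using exists_long_interval[OF assms(1,2,4)] by blast
  obtain i where i: "[b * i = 1] (mod a)"
    using cong_solve_coprime_int[of b a] cop by (auto simp: coprime_commute)
  \<comment> \<open>The first value from \<open>L\<close> on at which \<open>a\<close> divides n -
    bT.\<close>
  define k where "k = (n * i - L) mod a"
  define T0 where "T0 = L + k"
  have k: "0 \<le> k" "k < a" using assms(1) by (simp_all add: k_def)
  have "[T0 = n * i] (mod a)" by (simp add: T0_def k_def cong_def mod_add_right_eq)
  hence "[b * T0 = b * (n * i)] (mod a)" by (intro cong_mult cong_refl)
  also have "b * (n * i) = n * (b * i)" by (simp only: mult_ac)
  also have "[n * (b * i) = n * 1] (mod a)" by (intro cong_mult cong_refl i)
  finally have "[n = b * T0] (mod a)" using cong_sym by simp
  hence "a dvd n - b * T0" by (simp only: cong_iff_dvd_diff)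
  then obtain S0 where "n - b * T0 = a * S0" by (rule dvdE)
  hence S0: "n = a * S0 + b * T0" by simp
  \<comment> \<open>Replacing (S, T) by (S - b, T + a) preserves aS + bT and changes S - T by -(a +
    b). If a + b is even, both are odd and the parity hypothesis on \<open>n\<close> already gives
    the claim.\<close>
  have "\<exists>j\<in>{0, 1}. even ((S0 - j * b) - (T0 + j * a))"
  proof (cases "even (a + b)")
    case False
    thus ?thesis by auto
  next
    case True
    moreover have "\<not> (even a \<and> even b)" using cop(2) by (meson coprime_common_divisor odd_one)
    ultimately have "odd a" "odd b" by auto
    hence "even n" using assms(5) by simp
    hence "even (S0 + T0)" using S0 \<open>odd a\<close> \<open>odd b\<close> by simp
    thus ?thesis by auto
  qed
  then obtain j where j: "j = 0 \<or> j = 1" "even ((S0 - j * b) - (T0 + j * a))" by auto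
  \<comment> \<open>A further shift by \<open>2 * a\<close> keeps the parity of S - T but changes
    \<open>T\<close> modulo 5. The total shift k + ha is below 4a, which explains the length of the
    interval.\<close>
  have "\<not> 5 dvd 2 * a"
  proof
    assume "5 dvd 2 * a"
    hence "5 dvd a" by presburger
    with cop(1) have "is_unit (5 :: int)" by (rule coprime_common_divisor) simp
    thus False by simp
  qed
  hence "\<not> 5 dvd T0 + j * a \<or> \<not> 5 dvd T0 + j * a + 2 * a" by (metis dvd_add_right_iff)
  moreover have "T0 + j * a + 2 * a = T0 + (j + 2) * a" by (simp add: distrib_right)
  ultimately obtain h where h: "h = j \<or> h = j + 2" "\<not> 5 dvd T0 + h * a" by metis
  define S T where "S = S0 - h * b" and "T = T0 + h * a"
  have n_eq: "n = a * S + b * T" by (simp add: S0 S_def T_def algebra_simps)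
  have "L \<le> T"
    using k j h assms(1) by (auto simp: T_def T0_def)
  moreover have "T < L + 4 * a"
    using k j h assms(1) by (auto simp: T_def T0_def)
  ultimately have bounds: "4 * n \<le> a * T\<^sup>2 + 4 * b * T" "a * T\<^sup>2 + 5 * b * T < 5 * n" using L by blast+
  have "a * T\<^sup>2 < a * (5 * S)" "a * (4 * S) \<le> a * T\<^sup>2" using bounds by (simp_all add: n_eq algebra_simps)
  hence "T\<^sup>2 < 5 * S" "4 * S \<le> T\<^sup>2" using assms(1) by simp_all
  moreover have "even (S - T)" using j h by (auto simp: S_def T_def algebra_simps)
  moreover have "\<not> 5 dvd T" using h by (simp add: T_def)
  moreover have "T \<ge> 0" using \<open>L \<le> T\<close> L0 by simp
  ultimately obtain w x y z :: nat
    where "S = 2 * (int w)\<^sup>2 + (int x)\<^sup>2 + (int y)\<^sup>2 + (int z)\<^sup>2" "T = 2 * int w + int x + int y + int z"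
    using natural_representation by blast
  hence "2 * int w * (a * int w + b) + int x * (a * int x + b)
      + int y * (a * int y + b) + int z * (a * int z + b) = n"
    unfolding n_eq by (simp add: algebra_simps power2_eq_square)
  thus ?thesis by blast
qed

end
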